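(* Let $S$ be a nonempty set, let $\mathscr{E}$ be a Hilbert $C^*$-module over a $C^*$-algebra $\mathfrak{A}$, and let $K: S\times S\to \mathcal{L}(\mathscr{E})$ be a kernel. Then the following assertions are equivalent: (i) The kernel $K$ is positive definite. (ii) There is a Hilbert $\mathfrak{A}$-module $\mathscr{H}$ consisting of $\mathscr{E}$-valued functions on $S$ having the following properties: (1) For every $x\in\mathscr{E}$ and every $s\in S$, the function $K_{x,s}:S\to\mathscr{E}$ defined by $K_{x,s}(t):=K(s,t)(x)$, $t\in S$, is in $\mathscr{H}$, and the $\mathfrak{A}$-linear span of $\{K_{x,s}: x\in\mathscr{E}, s\in S\}$ is dense in $\mathscr{H}$. (2) The $\mathfrak{A}$-valued inner product on $\mathscr{H}$ is given by $$\langle K_{x,s},K_{y,t}\rangle=\langle K_{x,s}(t),y\rangle=\langle K(s,t)(x),y\rangle,\qquad x,y\in\mathscr{E},\ s,t\in S,$$ and extended to the whole of $\mathscr{H}$ by linearity (and continuity); indeed, for all $f\in\mathscr{H}$, $x\in\mathscr{E}$ and $s\in S$, it holds that $$\langle f(s),x\rangle=\langle f,K_{x,s}\rangle.$$ (iii) There are a Hilbert $\mathfrak{A}$-module $\mathscr{H}$ of $\mathscr{E}$-valued functions on $S$ and a feature map $\delta:S\to\mathcal{L}(\mathscr{H},\mathscr{E})$, $s\mapsto\delta_s$, where $\delta_s(f):=f(s)$, $f\in\mathscr{H}$, is the evaluation map at $s$, such that $K(s,t)=\delta_t\delta_s^*$ for all $s,t\in S$.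
   Context: All linear spaces are complex. Hilbert $C^*$-modules over $\mathfrak{A}$ (Hilbert $\mathfrak{A}$-modules) are right modules; the $\mathfrak{A}$-valued inner product is linear in the second variable, with $\langle x,ya\rangle=\langle x,y\rangle a$ and $\langle y,x\rangle=\langle x,y\rangle^*$. $\mathcal{L}(\mathscr{E},\mathscr{F})$ denotes the adjointable operators from $\mathscr{E}$ to $\mathscr{F}$, and $\mathcal{L}(\mathscr{E}):=\mathcal{L}(\mathscr{E},\mathscr{E})$. A kernel is a map $K:S\times S\to\mathcal{L}(\mathscr{E})$; it is hermitian if $K(t,s)=K(s,t)^*$ for all $s,t\in S$. A (hermitian) kernel $K$ is positive definite if $\sum_{i,j=1}^n\langle K(s_i,s_j)x_i,x_j\rangle\ge 0$ in $\mathfrak{A}$ for all $n\ge2$, all $s_1,\dots,s_n\in S$ and all $x_1,\dots,x_n\in\mathscr{E}$. Modules of $\mathscr{E}$-valued functions on $S$ carry the pointwise linear operations and the module action $(f\cdot a)(s)=f(s)a$. *)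

theory Defs
  imports "HOL-Analysis.Analysis" "HOL-Library.Function_Algebras"
begin

section \<open>C*-algebras\<close>

text \<open>No unit is assumed, and the zero algebra is allowed.\<close>

class cstar_algebra = real_normed_algebra + banach +
  fixes scaleC :: "complex \<Rightarrow> 'a \<Rightarrow> 'a"
    and star :: "'a \<Rightarrow> 'a"
  assumes scaleC_add_right: "scaleC c (a + b) = scaleC c a + scaleC c b"
    and scaleC_add_left: "scaleC (c + d) a = scaleC c a + scaleC d a"
    and scaleC_scaleC: "scaleC c (scaleC d a) = scaleC (c * d) a"
    and scaleC_of_real: "scaleC (complex_of_real r) a = r *\<^sub>R a"
    and norm_scaleC: "norm (scaleC c a) = cmod c * norm a"
    and scaleC_mult_left: "scaleC c a * b = scaleC c (a * b)"
    and scaleC_mult_right: "a * scaleC c b = scaleC c (a * b)"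
    and star_add: "star (a + b) = star a + star b"
    and star_scaleC: "star (scaleC c a) = scaleC (cnj c) (star a)"
    and star_mult: "star (a * b) = star b * star a"
    and star_star: "star (star a) = a"
    and cstar_identity: "norm (star a * a) = (norm a)\<^sup>2"

definition cstar_nonneg :: "'a::cstar_algebra \<Rightarrow> bool"
  where "cstar_nonneg a \<longleftrightarrow> (\<exists>b. a = star b * b)"

section \<open>Hilbert C*-modules\<close>

text \<open>The ambient right module is a whole type; a Hilbert module is a submodule \<open>M\<close> of it
  with an inner product, whose values outside \<open>M\<close> are irrelevant. This covers both the
  module \<open>E\<close> (with \<open>M = UNIV\<close>) and modules of \<open>E\<close>-valued functions (\<open>M\<close> a set of functions).\<close>

locale right_cstar_module = vector_space smul
  for smul :: "complex \<Rightarrow> 'm::ab_group_add \<Rightarrow> 'm" +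
  fixes act :: "'m \<Rightarrow> 'a::cstar_algebra \<Rightarrow> 'm"
  assumes act_add_left: "act (x + y) a = act x a + act y a"
    and act_add_right: "act x (a + b) = act x a + act x b"
    and act_mult: "act x (a * b) = act (act x a) b"
    and act_scale_left: "act (smul c x) a = smul c (act x a)"
    and act_scale_right: "act x (scaleC c a) = smul c (act x a)"

definition act_submodule ::
    "(complex \<Rightarrow> 'm::ab_group_add \<Rightarrow> 'm) \<Rightarrow> ('m \<Rightarrow> 'a::cstar_algebra \<Rightarrow> 'm) \<Rightarrow> 'm set \<Rightarrow> bool"
  where "act_submodule smul act V \<longleftrightarrow>
    module.subspace smul V \<and> (\<forall>x\<in>V. \<forall>a. act x a \<in> V)"

definition act_span ::
    "(complex \<Rightarrow> 'm::ab_group_add \<Rightarrow> 'm) \<Rightarrow> ('m \<Rightarrow> 'a::cstar_algebra \<Rightarrow> 'm) \<Rightarrow> 'm set \<Rightarrow> 'm set"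
  where "act_span smul act X = act_submodule smul act hull X"

text \<open>The guard makes the distance independent of the values of the inner product outside \<open>M\<close>
  (the locale \<open>Metric_space\<close> demands symmetry and nonnegativity everywhere).\<close>

definition ip_dist :: "'m::ab_group_add set \<Rightarrow> ('m \<Rightarrow> 'm \<Rightarrow> 'a::cstar_algebra) \<Rightarrow> 'm \<Rightarrow> 'm \<Rightarrow> real"
  where "ip_dist M ip x y =
    (if x \<in> M \<and> y \<in> M then sqrt (norm (ip (x - y) (x - y))) else 0)"

locale hilbert_cstar_module = right_cstar_module smul act
  for smul :: "complex \<Rightarrow> 'm::ab_group_add \<Rightarrow> 'm"
    and act :: "'m \<Rightarrow> 'a::cstar_algebra \<Rightarrow> 'm" +
  fixes M :: "'m set"
    and ip :: "'m \<Rightarrow> 'm \<Rightarrow> 'a"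
  assumes submodule: "act_submodule smul act M"
    and ip_add_right: "\<lbrakk>x \<in> M; y \<in> M; z \<in> M\<rbrakk> \<Longrightarrow> ip x (y + z) = ip x y + ip x z"
    and ip_scale_right: "\<lbrakk>x \<in> M; y \<in> M\<rbrakk> \<Longrightarrow> ip x (smul c y) = scaleC c (ip x y)"
    and ip_act_right: "\<lbrakk>x \<in> M; y \<in> M\<rbrakk> \<Longrightarrow> ip x (act y a) = ip x y * a"
    and ip_star: "\<lbrakk>x \<in> M; y \<in> M\<rbrakk> \<Longrightarrow> ip y x = star (ip x y)"
    and ip_nonneg: "x \<in> M \<Longrightarrow> cstar_nonneg (ip x x)"
    and ip_definite: "\<lbrakk>x \<in> M; ip x x = 0\<rbrakk> \<Longrightarrow> x = 0"
    and complete: "Metric_space.mcomplete M (ip_dist M ip)"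

definition dense_in_module ::
    "'m::ab_group_add set \<Rightarrow> ('m \<Rightarrow> 'm \<Rightarrow> 'a::cstar_algebra) \<Rightarrow> 'm set \<Rightarrow> bool"
  where "dense_in_module M ip X \<longleftrightarrow>
    X \<subseteq> M \<and> Metric_space.mtopology M (ip_dist M ip) closure_of X = M"

definition adjointable_ops ::
    "'m set \<Rightarrow> ('m \<Rightarrow> 'm \<Rightarrow> 'a) \<Rightarrow> 'n set \<Rightarrow> ('n \<Rightarrow> 'n \<Rightarrow> 'a) \<Rightarrow> ('m \<Rightarrow> 'n) set"
  where "adjointable_ops M ipM N ipN = {T. T \<in> M \<rightarrow> N \<and>
    (\<exists>T'. T' \<in> N \<rightarrow> M \<and> (\<forall>x\<in>M. \<forall>y\<in>N. ipN (T x) y = ipM x (T' y)))}"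

text \<open>The value at \<open>y\<close> is meaningful for \<open>T\<close> adjointable and \<open>y\<close> in the codomain of \<open>T\<close>;
  it is then unique because the inner product of \<open>M\<close> is definite.\<close>

definition adjoint_op ::
    "'m set \<Rightarrow> ('m \<Rightarrow> 'm \<Rightarrow> 'a) \<Rightarrow> ('n \<Rightarrow> 'n \<Rightarrow> 'a) \<Rightarrow> ('m \<Rightarrow> 'n) \<Rightarrow> 'n \<Rightarrow> 'm"
  where "adjoint_op M ipM ipN T y = (THE z. z \<in> M \<and> (\<forall>x\<in>M. ipN (T x) y = ipM x z))"

section \<open>Kernels\<close>

definition hermitian_kernel ::
    "('e \<Rightarrow> 'e \<Rightarrow> 'a) \<Rightarrow> ('s \<Rightarrow> 's \<Rightarrow> 'e \<Rightarrow> 'e) \<Rightarrow> bool"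
  where "hermitian_kernel ip K \<longleftrightarrow> (\<forall>s t. K t s = adjoint_op UNIV ip ip (K s t))"

definition pos_def_kernel ::
    "('e \<Rightarrow> 'e \<Rightarrow> 'a::cstar_algebra) \<Rightarrow> ('s \<Rightarrow> 's \<Rightarrow> 'e \<Rightarrow> 'e) \<Rightarrow> bool"
  where "pos_def_kernel ip K \<longleftrightarrow> hermitian_kernel ip K \<and>
    (\<forall>n\<ge>2. \<forall>(s :: nat \<Rightarrow> 's) (x :: nat \<Rightarrow> 'e).
       cstar_nonneg (\<Sum>i<n. \<Sum>j<n. ip (K (s i) (s j) (x i)) (x j)))"

text \<open>The hermitian condition is in fact implied by positivity of the sums.\<close>

lemma pos_def_kernel_iff:
  assumes E: "hilbert_cstar_module smul act UNIV ip"
    and K: "\<And>s t. K s t \<in> adjointable_ops UNIV ip UNIV ip"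
  shows "pos_def_kernel ip K \<longleftrightarrow>
    (\<forall>n\<ge>2. \<forall>(s :: nat \<Rightarrow> _) x. cstar_nonneg (\<Sum>i<n. \<Sum>j<n. ip (K (s i) (s j) (x i)) (x j)))"
proof -
  interpret hilbert_cstar_module smul act UNIV ip by fact
  have add_r: "ip x (y + z) = ip x y + ip x z" for x y z by (simp add: ip_add_right)
  have add_l: "ip (x + y) z = ip x z + ip y z" for x y z
    by (metis UNIV_I add_r ip_star star_add)
  have zero_r [simp]: "ip x 0 = 0" for x using add_r[of x 0 0] by simp
  have zero_l [simp]: "ip 0 x = 0" for x using add_l[of 0 0 x] by simp
  have scale_r: "ip x (smul c y) = scaleC c (ip x y)" for x y c by (simp add: ip_scale_right)
  have scale_l: "ip (smul c x) y = scaleC (cnj c) (ip x y)" for x y c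
    by (metis UNIV_I scale_r ip_star star_scaleC)
  have ext: "y = z" if "\<And>x. ip x y = ip x z" for y z
  proof -
    have "ip (y - z) (y - z) + ip (y - z) z = ip (y - z) y"
      by (simp flip: add_r)
    then have "ip (y - z) (y - z) = 0" using that[of "y - z"] by simp
    then show ?thesis using ip_definite[of "y - z"] by simp
  qed
  obtain A where A: "\<And>s t x y. ip (K s t x) y = ip x (A s t y)"
    using K unfolding adjointable_ops_def by simp metis
  have K_add: "K s t (x + y) = K s t x + K s t y"
    and K_scale: "K s t (smul c x) = smul c (K s t x)" for s t x y c
  proof -
    have "ip (K s t (x + y)) z = ip (K s t x + K s t y) z" for z by (simp add: A add_l)
    then show "K s t (x + y) = K s t x + K s t y" by (metis UNIV_I ext ip_star)
    have "ip (K s t (smul c x)) z = ip (smul c (K s t x)) z" for z by (simp add: A scale_l)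
    then show "K s t (smul c x) = smul c (K s t x)" by (metis UNIV_I ext ip_star)
  qed
  have K_zero [simp]: "K s t 0 = 0" for s t using K_add[of s t 0 0] by simp
  have "hermitian_kernel ip K"
    if pos: "\<forall>n\<ge>2. \<forall>(s :: nat \<Rightarrow> _) x. cstar_nonneg (\<Sum>i<n. \<Sum>j<n. ip (K (s i) (s j) (x i)) (x j))"
  proof -
    have sa: "star a = a" if "cstar_nonneg a" for a :: 'b
      using that by (auto simp: cstar_nonneg_def star_mult star_star)
    define Q where "Q s t x y = ip (K s t x) y" for s t x y
    have four: "star (Q s s x x + Q s t x y + (Q t s y x + Q t t y y)) =
        Q s s x x + Q s t x y + (Q t s y x + Q t t y y)" for s t x y
    proof (rule sa)
      show "cstar_nonneg (Q s s x x + Q s t x y + (Q t s y x + Q t t y y))"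
        using pos[rule_format, of 2 "\<lambda>i. if i = 0 then s else t" "\<lambda>i. if i = 0 then x else y"]
        by (simp add: Q_def numeral_2_eq_2)
    qed
    have diag: "star (Q s s x x) = Q s s x x" for s x
      using four[of s x s 0] by (simp add: Q_def)
    have pair: "star (Q s t x y) + star (Q t s y x) = Q s t x y + Q t s y x" for s t x y
      using four[of s x t y] by (simp add: star_add diag algebra_simps)
    have key: "ip (K s t x) y = ip x (K t s y)" for s t x y
    proof -
      let ?P = "Q s t x y" and ?R = "Q t s y x"
      have minus: "scaleC (- 1) a = - a" for a :: 'b
        using scaleC_of_real[of "-1" a] by simp
      have one: "scaleC 1 a = a" for a :: 'b using scaleC_of_real[of 1 a] by simp
      have minus': "scaleC (- c) a = - scaleC c a" for c and a :: 'b
        using scaleC_scaleC[of "-1" c a] by (simp add: minus)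
      have "scaleC (- \<i>) (star ?P) + scaleC \<i> (star ?R) = scaleC \<i> ?P + scaleC (- \<i>) ?R"
        using pair[of s t x "smul \<i> y"]
        by (simp add: Q_def K_scale scale_r scale_l star_scaleC)
      then have "scaleC (- \<i>) (scaleC (- \<i>) (star ?P) + scaleC \<i> (star ?R)) =
          scaleC (- \<i>) (scaleC \<i> ?P + scaleC (- \<i>) ?R)" by simp
      then have "star ?R - star ?P = ?P - ?R"
        by (simp add: scaleC_add_right scaleC_scaleC minus one)
      then have "(star ?R - star ?P) + (star ?P + star ?R) = (?P - ?R) + (?P + ?R)"
        by (simp only: pair)
      then have "star ?R + star ?R = ?P + ?P" by simp
      then have "2 *\<^sub>R star ?R = 2 *\<^sub>R ?P" by (simp only: scaleR_2)
      then have "star ?R = ?P" by simp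
      then show ?thesis unfolding Q_def by (metis UNIV_I ip_star)
    qed
    show ?thesis unfolding hermitian_kernel_def fun_eq_iff adjoint_op_def
      by (intro allI the_equality[symmetric]) (auto simp: key intro: ext)
  qed
  then show ?thesis by (auto simp: pos_def_kernel_def)
qed

definition kernel_fun :: "('s \<Rightarrow> 's \<Rightarrow> 'e \<Rightarrow> 'e) \<Rightarrow> 'e \<Rightarrow> 's \<Rightarrow> 's \<Rightarrow> 'e"
  where "kernel_fun K x s = (\<lambda>t. K s t x)"

definition fun_scale :: "(complex \<Rightarrow> 'e \<Rightarrow> 'e) \<Rightarrow> complex \<Rightarrow> ('s \<Rightarrow> 'e) \<Rightarrow> 's \<Rightarrow> 'e"
  where "fun_scale smul c f = (\<lambda>s. smul c (f s))"

definition fun_act :: "('e \<Rightarrow> 'a \<Rightarrow> 'e) \<Rightarrow> ('s \<Rightarrow> 'e) \<Rightarrow> 'a \<Rightarrow> 's \<Rightarrow> 'e"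
  where "fun_act act f a = (\<lambda>s. act (f s) a)"

lemma right_cstar_module_fun:
  assumes "right_cstar_module smul act"
  shows "right_cstar_module (fun_scale smul) (fun_act act)"
proof -
  interpret right_cstar_module smul act by fact
  show ?thesis
    by unfold_locales
      (simp_all add: fun_scale_def fun_act_def fun_eq_iff scale_right_distrib scale_left_distrib
        act_add_left act_add_right act_mult act_scale_left act_scale_right)
qed

text \<open>Hilbert modules of functions; addition is the pointwise one of \<open>Function_Algebras\<close>.\<close>

definition hilbert_function_module ::
    "(complex \<Rightarrow> 'e::ab_group_add \<Rightarrow> 'e) \<Rightarrow> ('e \<Rightarrow> 'a::cstar_algebra \<Rightarrow> 'e) \<Rightarrow>
      ('s \<Rightarrow> 'e) set \<Rightarrow> (('s \<Rightarrow> 'e) \<Rightarrow> ('s \<Rightarrow> 'e) \<Rightarrow> 'a) \<Rightarrow> bool"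
  where "hilbert_function_module smul act H ipH \<longleftrightarrow>
    hilbert_cstar_module (fun_scale smul) (fun_act act) H ipH"

end

theory Submission
  imports Defs
begin

text \<open>
  The equivalence is the module version of the Moore--Aronszajn theorem. Two implications only
  unfold definitions. If \<open>K s t = \<delta> t \<circ> (\<delta> s)\<^sup>*\<close>, then the sum in the definition of positive
  definiteness is \<open>\<langle>f, f\<rangle>\<close> for the vector \<open>f = \<Sum>i. (\<delta> (s i))\<^sup>* (x i)\<close>; see
  \<open>pos_def_kernel_of_feature_map\<close>. And the reproducing identity says exactly that
  \<open>x \<mapsto> K\<^bsub>x,s\<^esub>\<close> is the adjoint of the evaluation at \<open>s\<close>; see \<open>feature_map_of_reproducing\<close>.

  The work is in constructing the module of functions from a positive definite kernel (locale
  \<open>positive_kernel\<close>). On finitely supported families \<open>u\<close> of vectors the form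
  \<open>\<langle>u, v\<rangle> = \<Sum>s t. \<langle>K s t (u s), v t\<rangle>\<close> is a semi-inner product by positivity. The family \<open>u\<close> stands
  for the function \<open>kmap u = \<Sum>s. K\<^bsub>u s,s\<^esub>\<close>, and pairing \<open>u\<close> with a family concentrated at a
  single point evaluates this function (\<open>ipV_single\<close>). Each evaluation is bounded with respect to
  the seminorm (\<open>kmap_bounded\<close>), so a Cauchy sequence of families has a pointwise limit function.
  These limits form \<open>H\<close>. A Cauchy sequence with limit function \<open>0\<close> is a null sequence
  (\<open>represents_zero_imp_null\<close>), hence the inner product of two functions may be computed from any
  representing sequences (\<open>LIMSEQ_ipH\<close>), and all axioms, the reproducing identity and
  completeness follow by passing to the limit.

  This needs two facts on positive elements, which are by definition the elements
  \<open>b\<^sup>* b\<close>: the set of positive elements is closed (\<open>cstar_nonneg_LIMSEQ\<close>), and there is a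
  Cauchy--Schwarz inequality (\<open>cauchy_schwarz_cstar\<close>). Both hold once \<open>b\<^sup>* b\<close> is known to be the
  square of a self-adjoint element. In a unital algebra the squares of self-adjoint
  elements are the self-adjoint \<open>a\<close> with \<open>\<parallel>t - a\<parallel> \<le> t\<close> for some real \<open>t\<close> (\<open>sa_square_iff\<close>), a
  description that visibly gives a closed cone; the square root comes from the binomial series, so
  no spectral theory enters. That \<open>b\<^sup>* b\<close> is such a square is Kaplansky's argument
  (\<open>star_mult_self_is_sa_square\<close>). The general case is reduced to the unital one by adjoining
  a unit.

  The boundedness of the evaluations rests on that of the operator \<open>K s s\<close>, which is a
  Hellinger--Toeplitz theorem, proved here with the Baire category theorem
  (\<open>adjointable_imp_bounded\<close>).
\<close>

section \<open>Scalars, involution and norm in a C*-algebra\<close>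

lemma scaleC_one [simp]: "scaleC 1 (a::'a::cstar_algebra) = a"
  using scaleC_of_real[of 1 a] by simp

lemma scaleC_zero_left [simp]: "scaleC 0 (a::'a::cstar_algebra) = 0"
  using scaleC_of_real[of 0 a] by simp

lemma scaleC_zero_right [simp]: "scaleC c (0::'a::cstar_algebra) = 0"
  using scaleC_add_right[of c 0 "0::'a"] by simp

lemma scaleC_minus_right: "scaleC c (- (a::'a::cstar_algebra)) = - scaleC c a"
  using scaleC_add_right[of c a "- a"] by (simp add: eq_neg_iff_add_eq_0 add.commute)

lemma scaleC_minus_left: "scaleC (- c) (a::'a::cstar_algebra) = - scaleC c a"
  using scaleC_add_left[of c "- c" a] by (simp add: eq_neg_iff_add_eq_0 add.commute)

lemma scaleC_diff_right: "scaleC c (a - b) = scaleC c a - scaleC c (b::'a::cstar_algebra)"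
  using scaleC_add_right[of c a "- b"] by (simp add: scaleC_minus_right)

lemma scaleC_scaleR: "scaleC c (r *\<^sub>R a) = r *\<^sub>R scaleC c (a::'a::cstar_algebra)"
  by (simp add: scaleC_of_real[symmetric] scaleC_scaleC mult.commute)

lemma star_zero [simp]: "star (0::'a::cstar_algebra) = 0"
  using star_add[of 0 "0::'a"] by simp

lemma star_minus: "star (- (a::'a::cstar_algebra)) = - star a"
  using star_add[of a "- a"] by (simp add: eq_neg_iff_add_eq_0 add.commute)

lemma star_diff: "star (a - b) = star a - star (b::'a::cstar_algebra)"
  using star_add[of a "- b"] by (simp add: star_minus)

lemma star_scaleR: "star (r *\<^sub>R a) = r *\<^sub>R star (a::'a::cstar_algebra)"
  by (simp add: scaleC_of_real[symmetric] star_scaleC)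

lemma star_one [simp]: "star (1::'a::{cstar_algebra,ring_1}) = 1"
  using star_mult[of "star 1" "1::'a"] by (simp add: star_star)

lemma norm_le_norm_star: "norm (a::'a::cstar_algebra) \<le> norm (star a)"
proof -
  have "norm a * norm a \<le> norm (star a) * norm a"
    using norm_mult_ineq[of "star a" a] by (simp add: cstar_identity power2_eq_square)
  then show ?thesis
    by (metis mult_le_cancel_right norm_ge_zero norm_le_zero_iff order_le_less not_less)
qed

lemma norm_star [simp]: "norm (star a) = norm (a::'a::cstar_algebra)"
  using norm_le_norm_star[of a] norm_le_norm_star[of "star a"] by (simp add: star_star)

lemma bounded_linear_star: "bounded_linear (star :: 'a::cstar_algebra \<Rightarrow> 'a)"
  by (rule bounded_linear_intro[where K = 1]) (simp_all add: star_add star_scaleR)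

lemma bounded_linear_scaleC: "bounded_linear (scaleC c :: 'a::cstar_algebra \<Rightarrow> 'a)"
  by (rule bounded_linear_intro[where K = "cmod c"])
    (simp_all add: scaleC_add_right scaleC_scaleR norm_scaleC mult.commute)

lemma norm_self_adjoint_square: "star a = a \<Longrightarrow> norm (a * a) = (norm (a::'a::cstar_algebra))\<^sup>2"
  using cstar_identity[of a] by simp

lemma star_power: "star (a ^ n) = star (a::'a::{cstar_algebra,ring_1}) ^ n"
  by (induction n) (simp_all add: star_mult power_commutes)

section \<open>Square roots in unital C*-algebras\<close>

text \<open>The coefficients of the power series of \<open>sqrt (1 - z)\<close>. All of them except the constant one
  are nonpositive and their partial sums stay nonnegative, so the series converges absolutely up to
  and including \<open>\<bar>z\<bar> = 1\<close>. The boundary matters: for \<open>z = 1 - a / t\<close> with \<open>a\<close> positive and not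
  invertible the norm of \<open>z\<close> is one.\<close>
definition sqrt_coeff :: "nat \<Rightarrow> real"
  where "sqrt_coeff k = (1/2 gchoose k) * (- 1) ^ k"

lemma sqrt_coeff_0 [simp]: "sqrt_coeff 0 = 1"
  by (simp add: sqrt_coeff_def)

lemma sqrt_coeff_Suc_nonpos: "sqrt_coeff (Suc k) \<le> 0"
proof (induction k)
  case (Suc k)
  have "sqrt_coeff (Suc (Suc k)) * real (Suc (Suc k)) = sqrt_coeff (Suc k) * (real (Suc k) - 1/2)"
  proof -
    have "(1/2 gchoose Suc (Suc k)) * real (Suc (Suc k)) = (1/2 gchoose Suc k) * (1/2 - real (Suc k))"
      using gbinomial_mult_1[of "1/2 :: real" "Suc k"] by (simp add: algebra_simps)
    then have "((1/2 gchoose Suc (Suc k)) * real (Suc (Suc k))) * (- 1) ^ k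
        = ((1/2 gchoose Suc k) * (1/2 - real (Suc k))) * (- 1) ^ k"
      by (rule arg_cong)
    then show ?thesis
      by (simp add: sqrt_coeff_def algebra_simps)
  qed
  also have "\<dots> \<le> 0"
    using Suc by (intro mult_nonpos_nonneg) auto
  finally show ?case
    by (simp add: mult_le_0_iff)
qed (simp add: sqrt_coeff_def)

lemma sqrt_coeff_partial_sum: "0 \<le> (\<Sum>k\<le>n. sqrt_coeff k)"
proof -
  have "0 \<le> (- 1) ^ n * (- 1/2 gchoose n :: real)"
  proof (induction n)
    case (Suc n)
    have "(- 1) ^ Suc n * (- 1/2 gchoose Suc n :: real) * real (Suc n)
        = (- 1) ^ n * (- 1/2 gchoose n) * (real n + 1/2)"
    proof -
      have "(- 1/2 gchoose Suc n) * real (Suc n) = (- 1/2 gchoose n) * (- 1/2 - real n)"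
        using gbinomial_mult_1[of "- 1/2 :: real" n] by (simp add: algebra_simps)
      then have "((- 1/2 gchoose Suc n) * real (Suc n)) * (- 1) ^ n
          = ((- 1/2 gchoose n) * (- 1/2 - real n)) * (- 1) ^ n"
        by (rule arg_cong)
      then show ?thesis
        by (simp add: algebra_simps)
    qed
    also have "\<dots> \<ge> 0"
      using Suc by (intro mult_nonneg_nonneg[of "_ * _"]) auto
    finally show ?case
      by (subst (asm) zero_le_mult_iff) simp
  qed simp
  also have "\<dots> = (\<Sum>k\<le>n. sqrt_coeff k)"
    using gbinomial_sum_lower_neg[of "1/2 :: real" n] by (simp add: sqrt_coeff_def)
  finally show ?thesis .
qed

lemma sum_abs_sqrt_coeff_le: "(\<Sum>k<n. \<bar>sqrt_coeff (Suc k)\<bar>) \<le> 1"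
proof -
  have "(\<Sum>k\<le>n. sqrt_coeff k) = 1 + (\<Sum>k<n. sqrt_coeff (Suc k))"
    by (simp add: sum.atMost_shift)
  also have "(\<Sum>k<n. sqrt_coeff (Suc k)) = - (\<Sum>k<n. \<bar>sqrt_coeff (Suc k)\<bar>)"
    by (simp add: sum_negf[symmetric] abs_of_nonpos[OF sqrt_coeff_Suc_nonpos])
  finally show ?thesis
    using sqrt_coeff_partial_sum[of n] by simp
qed

lemma summable_abs_sqrt_coeff: "summable (\<lambda>k. \<bar>sqrt_coeff k\<bar>)"
  by (subst summable_Suc_iff[symmetric], rule bounded_imp_summable[of _ 1])
    (use sum_abs_sqrt_coeff_le[of "Suc _"] in \<open>auto simp: lessThan_Suc_atMost\<close>)

lemma sqrt_coeff_convolution: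
  "(\<Sum>i\<le>k. sqrt_coeff i * sqrt_coeff (k - i)) = (if k = 0 then 1 else if k = 1 then - 1 else 0)"
proof -
  have "(\<Sum>i\<le>k. sqrt_coeff i * sqrt_coeff (k - i))
      = (- 1) ^ k * (\<Sum>i\<le>k. (1/2 gchoose i) * (1/2 gchoose (k - i)))"
    unfolding sum_distrib_left
    by (rule sum.cong) (auto simp: sqrt_coeff_def power_add[symmetric] mult_ac)
  also have "\<dots> = (- 1) ^ k * (1 gchoose k)"
    using gbinomial_Vandermonde[of "1/2 :: real" "1/2" k] by (simp add: atLeast0AtMost)
  also have "\<dots> = (- 1) ^ k * of_nat (1 choose k)"
    using binomial_gbinomial[of 1 k, where 'a = real] by simp
  finally show ?thesis
    by (auto simp: binomial_eq_0)
qed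

text \<open>The root is the sum of the binomial series at \<open>z\<close>. As a limit of polynomials in \<open>z\<close> it commutes
  with everything that commutes with \<open>z\<close>; the bound on \<open>1 - w\<close> is the sum of the absolute values
  of the coefficients other than the constant one, and will show that \<open>w\<close> itself is a square.\<close>
lemma sqrt_one_minus:
  fixes z :: "'a::{cstar_algebra,real_normed_algebra_1}"
  assumes z: "star z = z" "norm z \<le> 1"
  obtains w where "star w = w" "w * w = 1 - z" "norm (1 - w) \<le> 1"
    "\<And>x. x * z = z * x \<Longrightarrow> x * w = w * x"
proof
  define f where "f k = sqrt_coeff k *\<^sub>R z ^ k" for k
  have norm_f: "norm (f k) \<le> \<bar>sqrt_coeff k\<bar>" for k
  proof -
    have "norm (z ^ k) \<le> 1"
      using norm_power_ineq[of z k] power_le_one[of "norm z" k] z by simp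
    then show ?thesis
      by (simp add: f_def mult_left_le)
  qed
  have summable_norm: "summable (\<lambda>k. norm (f k))"
    by (rule summable_comparison_test'[OF summable_abs_sqrt_coeff]) (simp add: norm_f)
  then have summable: "summable f"
    by (rule summable_norm_cancel)
  define w where "w = suminf f"
  have w: "f sums w"
    unfolding w_def using summable by (rule summable_sums)
  have "(\<lambda>k. star (f k)) sums star w"
    using w by (rule bounded_linear.sums[OF bounded_linear_star])
  moreover have "star (f k) = f k" for k
    by (simp add: f_def star_scaleR star_power z)
  ultimately show "star w = w"
    using w sums_unique2 by auto
  show "x * w = w * x" if "x * z = z * x" for x
  proof -
    have "x * z ^ k = z ^ k * x" for k
      using that by (simp add: power_commuting_commutes)
    then have "(\<lambda>k. x * f k) = (\<lambda>k. f k * x)"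
      by (simp add: f_def)
    then show ?thesis
      using sums_mult[OF w, of x] sums_mult2[OF w, of x] sums_unique2 by auto
  qed
  have "(\<Sum>i\<le>k. f i * f (k - i)) = (if k = 0 then 1 else if k = 1 then - z else 0)" for k
  proof -
    have "(\<Sum>i\<le>k. f i * f (k - i)) = (\<Sum>i\<le>k. sqrt_coeff i * sqrt_coeff (k - i)) *\<^sub>R z ^ k"
      unfolding scaleR_sum_left
      by (rule sum.cong) (auto simp: f_def power_add[symmetric])
    then show ?thesis
      by (simp add: sqrt_coeff_convolution)
  qed
  moreover have "(\<lambda>k. if k = 0 then 1 else if k = 1 then - z else 0) sums (1 - z)"
    using sums_finite[of "{0,1::nat}" "\<lambda>k. if k = 0 then 1 else if k = 1 then - z else 0"] by simp
  moreover have "(\<lambda>k. \<Sum>i\<le>k. f i * f (k - i)) sums (w * w)"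
    unfolding w_def using Cauchy_product_sums[OF summable_norm summable_norm] by simp
  ultimately show "w * w = 1 - z"
    using sums_unique2 by auto
  have "(\<lambda>k. f (Suc k)) sums (w - 1)"
    using w unfolding sums_Suc_iff by (simp add: f_def)
  then have "(\<lambda>n. norm (\<Sum>k<n. f (Suc k))) \<longlonglongrightarrow> norm (w - 1)"
    unfolding sums_def by (rule tendsto_norm)
  moreover have "norm (\<Sum>k<n. f (Suc k)) \<le> 1" for n
  proof -
    have "norm (\<Sum>k<n. f (Suc k)) \<le> (\<Sum>k<n. \<bar>sqrt_coeff (Suc k)\<bar>)"
      by (rule order_trans[OF norm_sum sum_mono]) (rule norm_f)
    then show ?thesis
      using sum_abs_sqrt_coeff_le[of n] by simp
  qed
  ultimately have "norm (w - 1) \<le> 1"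
    by (intro LIMSEQ_le_const2) auto
  then show "norm (1 - w) \<le> 1"
    by (simp add: norm_minus_commute)
qed

text \<open>The previous lemma applied to \<open>z = 1 - a / t\<close>.\<close>
lemma sqrt_of_norm_le:
  fixes a :: "'a::{cstar_algebra,real_normed_algebra_1}"
  assumes a: "star a = a" "norm (t *\<^sub>R 1 - a) \<le> t"
  obtains w where "star w = w" "w * w = a" "norm (sqrt t *\<^sub>R 1 - w) \<le> sqrt t"
    "\<And>x. x * a = a * x \<Longrightarrow> x * w = w * x"
proof (cases "t = 0")
  case True
  with a have "a = 0" by simp
  then show ?thesis
    using that[of 0] True by simp
next
  case False
  have "0 \<le> t"
    using a(2) norm_ge_zero order_trans by blast
  with False have t: "t > 0" by simp
  define z where "z = 1 - (1 / t) *\<^sub>R a"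
  have "star z = z"
    by (simp add: z_def star_diff star_scaleR a)
  moreover have "norm z \<le> 1"
  proof -
    have "z = (1 / t) *\<^sub>R (t *\<^sub>R 1 - a)"
      using t by (simp add: z_def scaleR_diff_right)
    then show ?thesis
      using a t by (simp add: divide_simps)
  qed
  ultimately obtain w where w: "star w = w" "w * w = 1 - z" "norm (1 - w) \<le> 1"
    "\<And>x. x * z = z * x \<Longrightarrow> x * w = w * x"
    using sqrt_one_minus by blast
  show ?thesis
  proof (rule that[of "sqrt t *\<^sub>R w"])
    show "sqrt t *\<^sub>R w * sqrt t *\<^sub>R w = a"
      using t by (simp add: w z_def)
    have "sqrt t *\<^sub>R 1 - sqrt t *\<^sub>R w = sqrt t *\<^sub>R (1 - w)"
      by (simp add: scaleR_diff_right)
    then show "norm (sqrt t *\<^sub>R 1 - sqrt t *\<^sub>R w) \<le> sqrt t"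
      using w(3) t by (simp add: mult_left_le)
    show "x * (sqrt t *\<^sub>R w) = sqrt t *\<^sub>R w * x" if "x * a = a * x" for x
      using w(4)[of x] that by (simp add: z_def algebra_simps)
  qed (simp add: star_scaleR w)
qed

text \<open>The element \<open>u = a + \<i> b\<close> satisfies \<open>u\<^sup>* u = a\<^sup>2 + b\<^sup>2 = t\<close>, so its norm is \<open>sqrt t\<close>, and \<open>a\<close> is
  the real part of \<open>u\<close>. This replaces the spectral mapping theorem.\<close>
lemma norm_le_of_sum_squares:
  fixes a b :: "'a::{cstar_algebra,real_normed_algebra_1}"
  assumes "star a = a" "star b = b" "a * b = b * a" "a * a + b * b = t *\<^sub>R 1" "0 \<le> t"
  shows "(norm a)\<^sup>2 \<le> t"
proof -
  define u where "u = a + scaleC \<i> b"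
  have su: "star u = a - scaleC \<i> b"
    by (simp add: u_def star_add star_scaleC assms scaleC_minus_left)
  have "star u * u = a * a + b * b"
    unfolding su by (simp add: u_def ring_distribs scaleC_mult_left scaleC_mult_right scaleC_scaleC
        scaleC_minus_left assms(3) scaleC_add_right scaleC_diff_right)
  then have norm_u: "(norm u)\<^sup>2 = t"
    using cstar_identity[of u] assms(4,5) by simp
  have "u + star u = 2 *\<^sub>R a"
    unfolding su by (simp add: u_def scaleR_2)
  then have "2 * norm a = norm (u + star u)"
    by simp
  also have "\<dots> \<le> 2 * norm u"
    using norm_triangle_ineq[of u "star u"] by simp
  finally show ?thesis
    using norm_u power_mono[of "norm a" "norm u" 2] by simp
qed

section \<open>Positive elements of a unital C*-algebra\<close>

text \<open>Let \<open>b\<close> be the square root of \<open>t - a\<^sup>2\<close>. It commutes with \<open>a\<close>, and \<open>b\<^sup>2 + a\<^sup>2 = t\<close> bounds the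
  norm of \<open>b\<close>.\<close>
lemma norm_diff_square_le:
  fixes a :: "'a::{cstar_algebra,real_normed_algebra_1}"
  assumes a: "star a = a" "(norm a)\<^sup>2 \<le> t"
  shows "norm (t *\<^sub>R 1 - a * a) \<le> t"
proof -
  have t: "0 \<le> t"
    using a(2) zero_le_power2 order_trans by blast
  have "norm (t *\<^sub>R 1 - (t *\<^sub>R 1 - a * a)) \<le> t"
    using a by (simp add: norm_self_adjoint_square)
  moreover have "star (t *\<^sub>R 1 - a * a) = t *\<^sub>R 1 - a * a"
    by (simp add: star_diff star_scaleR star_mult a)
  ultimately obtain b where b: "star b = b" "b * b = t *\<^sub>R 1 - a * a"
    "\<And>x. x * (t *\<^sub>R 1 - a * a) = (t *\<^sub>R 1 - a * a) * x \<Longrightarrow> x * b = b * x"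
    using sqrt_of_norm_le by blast
  have "b * a = a * b"
    by (rule b(3)[symmetric]) (simp add: algebra_simps)
  moreover have "b * b + a * a = t *\<^sub>R 1"
    by (simp add: b(2))
  ultimately have "(norm b)\<^sup>2 \<le> t"
    using t by (rule norm_le_of_sum_squares[OF b(1) a(1)])
  then show ?thesis
    using norm_self_adjoint_square[OF b(1)] by (simp add: b(2))
qed

text \<open>A working notion of positivity. Such an element is clearly of the form \<open>b\<^sup>* b\<close>; the converse is
  the deep fact \<open>star_mult_self_is_sa_square\<close>.\<close>
definition sa_square :: "'a::cstar_algebra \<Rightarrow> bool"
  where "sa_square a \<longleftrightarrow> (\<exists>c. star c = c \<and> a = c * c)"

lemma sa_squareI: "star c = c \<Longrightarrow> sa_square (c * c)"
  by (auto simp: sa_square_def)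

lemma sa_square_self_adjoint: "sa_square a \<Longrightarrow> star a = a"
  by (auto simp: sa_square_def star_mult)

lemma sa_square_norm_diff:
  fixes a :: "'a::{cstar_algebra,real_normed_algebra_1}"
  assumes "sa_square a" "norm a \<le> t"
  shows "norm (t *\<^sub>R 1 - a) \<le> t"
  using assms norm_diff_square_le by (auto simp: sa_square_def norm_self_adjoint_square)

text \<open>The right-hand side makes no mention of a root, so it is preserved by sums and limits.\<close>
lemma sa_square_iff:
  fixes a :: "'a::{cstar_algebra,real_normed_algebra_1}"
  shows "sa_square a \<longleftrightarrow> star a = a \<and> (\<exists>t. norm (t *\<^sub>R 1 - a) \<le> t)"
proof
  assume "sa_square a"
  then show "star a = a \<and> (\<exists>t. norm (t *\<^sub>R 1 - a) \<le> t)"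
    using sa_square_norm_diff[OF _ order_refl] sa_square_self_adjoint by blast
next
  assume "star a = a \<and> (\<exists>t. norm (t *\<^sub>R 1 - a) \<le> t)"
  then obtain t where "star a = a" "norm (t *\<^sub>R 1 - a) \<le> t"
    by blast
  then obtain w where "star w = w" "w * w = a"
    by (rule sqrt_of_norm_le)
  then show "sa_square a"
    using sa_squareI[of w] by simp
qed

text \<open>The root can be chosen positive, which is what makes \<open>sqrt (h\<^sup>2)\<close> an absolute value of \<open>h\<close>.\<close>
lemma sa_square_sqrt:
  fixes a :: "'a::{cstar_algebra,real_normed_algebra_1}"
  assumes "sa_square a"
  obtains w where "sa_square w" "w * w = a" "\<And>x. x * a = a * x \<Longrightarrow> x * w = w * x"
proof -
  obtain w where w: "star w = w" "w * w = a" "norm (sqrt (norm a) *\<^sub>R 1 - w) \<le> sqrt (norm a)"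
      "\<And>x. x * a = a * x \<Longrightarrow> x * w = w * x"
    using sqrt_of_norm_le[OF sa_square_self_adjoint[OF assms] sa_square_norm_diff[OF assms order_refl]]
    by blast
  have "sa_square w"
    unfolding sa_square_iff using w by blast
  with w show ?thesis
    using that by blast
qed

lemma sa_square_add:
  fixes a b :: "'a::{cstar_algebra,real_normed_algebra_1}"
  assumes "sa_square a" "sa_square b"
  shows "sa_square (a + b)"
proof -
  obtain s t where st: "norm (s *\<^sub>R 1 - a) \<le> s" "norm (t *\<^sub>R 1 - b) \<le> t"
    using assms by (auto simp: sa_square_iff)
  have eq: "(s + t) *\<^sub>R 1 - (a + b) = (s *\<^sub>R 1 - a) + (t *\<^sub>R 1 - b)"
    by (simp add: algebra_simps)
  have "norm ((s + t) *\<^sub>R 1 - (a + b)) \<le> s + t"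
    unfolding eq using norm_triangle_ineq[of "s *\<^sub>R 1 - a" "t *\<^sub>R 1 - b"] st by linarith
  then show ?thesis
    using assms by (auto simp: sa_square_iff star_add)
qed

lemma sa_square_scaleR: "\<lbrakk>sa_square a; 0 \<le> r\<rbrakk> \<Longrightarrow> sa_square (r *\<^sub>R (a::'a::cstar_algebra))"
proof -
  assume "sa_square a" "0 \<le> r"
  then obtain c where "star c = c" "a = c * c"
    by (auto simp: sa_square_def)
  with \<open>0 \<le> r\<close> show ?thesis
    using sa_squareI[of "sqrt r *\<^sub>R c"] by (simp add: star_scaleR)
qed

lemma sa_square_of_real_diff:
  fixes a :: "'a::{cstar_algebra,real_normed_algebra_1}"
  assumes "star a = a" "norm a \<le> t"
  shows "sa_square (t *\<^sub>R 1 - a)"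
  using assms by (auto simp: sa_square_iff star_diff star_scaleR intro!: exI[of _ t])

text \<open>For \<open>t = \<parallel>p + q\<parallel>\<close> the element \<open>t - p = (t - (p + q)) + q\<close> is positive. If \<open>c\<close> and \<open>w\<close> are
  commuting square roots of \<open>p\<close> and \<open>t - p\<close>, then \<open>c\<^sup>2 + w\<^sup>2 = t\<close> bounds the norm of \<open>c\<close>.\<close>
lemma sa_square_norm_mono:
  fixes p q :: "'a::{cstar_algebra,real_normed_algebra_1}"
  assumes p: "sa_square p" and q: "sa_square q"
  shows "norm p \<le> norm (p + q)"
proof -
  define t where "t = norm (p + q)"
  have "sa_square (t *\<^sub>R 1 - (p + q) + q)"
    using p q by (intro sa_square_add sa_square_of_real_diff)
      (auto simp: t_def star_add sa_square_self_adjoint)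
  then have "sa_square (t *\<^sub>R 1 - p)"
    by simp
  then obtain w where w: "sa_square w" "w * w = t *\<^sub>R 1 - p"
      "\<And>x. x * (t *\<^sub>R 1 - p) = (t *\<^sub>R 1 - p) * x \<Longrightarrow> x * w = w * x"
    using sa_square_sqrt by blast
  obtain c where c: "star c = c" "p = c * c"
    using p by (auto simp: sa_square_def)
  have "c * w = w * c"
    by (rule w(3)) (simp add: c algebra_simps)
  moreover have "c * c + w * w = t *\<^sub>R 1"
    by (simp add: w(2) c(2))
  moreover have "0 \<le> t"
    by (simp add: t_def)
  ultimately have "(norm c)\<^sup>2 \<le> t"
    by (rule norm_le_of_sum_squares[OF c(1) sa_square_self_adjoint[OF w(1)]])
  then show ?thesis
    by (simp add: c norm_self_adjoint_square t_def)
qed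

text \<open>Kaplansky's argument. For \<open>h = b\<^sup>* b\<close> and \<open>m = \<bar>h\<bar>\<close> the element \<open>v = m - h\<close> is twice the negative
  part of \<open>h\<close>, and has to vanish. For \<open>d = b v\<close> one computes \<open>d\<^sup>* d = v h v = - v m v = - c\<^sup>2\<close> with \<open>c\<close>
  self-adjoint. Then for \<open>f = d c\<close> both \<open>f\<^sup>* f = - c\<^sup>4\<close> and \<open>f f\<^sup>* = - (d d\<^sup>*)\<^sup>2\<close> are negative, whereas
  \<open>f\<^sup>* f + f f\<^sup>*\<close> is half the sum of the squares of the self-adjoint elements \<open>f + f\<^sup>*\<close> and
  \<open>\<i> (f - f\<^sup>*)\<close>. Monotonicity of the norm on positive elements forces \<open>c = 0\<close>, and then
  \<open>d\<close>, \<open>h v\<close> and \<open>v\<close> vanish in turn.\<close>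
lemma star_mult_self_is_sa_square:
  fixes b :: "'a::{cstar_algebra,real_normed_algebra_1}"
  shows "sa_square (star b * b)"
proof -
  define h where "h = star b * b"
  have h: "star h = h"
    by (simp add: h_def star_mult star_star)
  \<comment> \<open>\<open>m\<close> is the absolute value of \<open>h\<close>, and \<open>n\<close> its square root.\<close>
  obtain m where m: "sa_square m" "m * m = h * h" "\<And>x. x * (h * h) = (h * h) * x \<Longrightarrow> x * m = m * x"
    using sa_square_sqrt[OF sa_squareI[OF h]] by blast
  obtain n where n: "sa_square n" "n * n = m" "\<And>x. x * m = m * x \<Longrightarrow> x * n = n * x"
    using sa_square_sqrt[OF m(1)] by blast
  note sa [simp] = h sa_square_self_adjoint[OF m(1)] sa_square_self_adjoint[OF n(1)]
  have hm: "h * m = m * h"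
    by (rule m(3)) (simp add: algebra_simps)
  define v where "v = m - h"
  have v [simp]: "star v = v"
    by (simp add: v_def star_diff)
  have vm: "v * m = m * v"
    by (simp add: v_def algebra_simps hm)
  have vn: "v * n = n * v"
    by (rule n(3)) (rule vm)
  have hv: "h * v = - (m * v)"
    by (simp add: v_def algebra_simps hm m(2))
  define c where "c = n * v"
  have c [simp]: "star c = c"
    by (simp add: c_def star_mult vn)
  define d where "d = b * v"
  have dd: "star d * d = - (c * c)"
  proof -
    have "star d * d = v * (h * v)"
      by (simp add: d_def h_def star_mult mult.assoc)
    also have "\<dots> = - ((v * n) * (n * v))"
      by (simp add: hv n(2)[symmetric] mult.assoc)
    finally show ?thesis
      by (simp add: c_def vn)
  qed
  define e where "e = d * star d"
  have e [simp]: "star e = e"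
    by (simp add: e_def star_mult star_star)
  define f where "f = d * c"
  have ff: "star f * f = - ((c * c) * (c * c))"
  proof -
    have "star f * f = c * (star d * d) * c"
      by (simp add: f_def star_mult mult.assoc)
    then show ?thesis
      unfolding dd by (simp add: mult.assoc)
  qed
  have ff': "f * star f = - (e * e)"
  proof -
    have "f * star f = d * (c * c) * star d"
      by (simp add: f_def star_mult mult.assoc)
    also have "c * c = - (star d * d)"
      by (simp add: dd)
    finally show ?thesis
      by (simp add: e_def mult.assoc)
  qed
  \<comment> \<open>Twice the real part and, up to sign, twice the imaginary part of \<open>f\<close>.\<close>
  define x where "x = f + star f"
  define y where "y = scaleC \<i> (f - star f)"
  have x: "star x = x" and y: "star y = y"
    by (simp_all add: x_def y_def star_add star_star star_scaleC star_diff scaleC_minus_left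
        scaleC_diff_right)
  have "x * x + y * y = 2 *\<^sub>R (star f * f + f * star f)"
    by (simp add: x_def y_def scaleC_mult_left scaleC_mult_right scaleC_scaleC
        scaleC_minus_left scaleC_diff_right scaleR_2 algebra_simps)
  then have "(1/2) *\<^sub>R (x * x + y * y) = - ((c * c) * (c * c)) - e * e"
    by (simp add: ff ff')
  then have "(c * c) * (c * c) + ((1/2) *\<^sub>R (x * x) + ((1/2) *\<^sub>R (y * y) + e * e)) = 0"
    by (simp add: scaleR_add_right add.assoc[symmetric])
  moreover have "sa_square ((1/2) *\<^sub>R (x * x) + ((1/2) *\<^sub>R (y * y) + e * e))"
    using x y by (intro sa_square_add sa_square_scaleR sa_squareI) auto
  moreover have "sa_square ((c * c) * (c * c))"
    by (rule sa_squareI) (simp add: star_mult)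
  ultimately have "norm ((c * c) * (c * c)) \<le> norm (0::'a)"
    using sa_square_norm_mono[of "(c * c) * (c * c)"
        "(1/2) *\<^sub>R (x * x) + ((1/2) *\<^sub>R (y * y) + e * e)"] by simp
  then have "c = 0"
    using norm_self_adjoint_square[of "c * c"] norm_self_adjoint_square[of c]
    by (simp add: star_mult)
  then have "d = 0"
    using dd cstar_identity[of d] by simp
  then have "h * v = 0"
    by (simp add: d_def h_def mult.assoc)
  then have "v * v = 0"
    using hv left_diff_distrib[of m h v] by (simp add: v_def[symmetric])
  then have "v = 0"
    using norm_self_adjoint_square[of v] by simp
  then show ?thesis
    using m(1) by (simp add: v_def h_def)
qed

lemma sa_square_LIMSEQ:
  fixes a :: "'a::{cstar_algebra,real_normed_algebra_1}"
  assumes X: "\<And>n. sa_square (X n)" "X \<longlonglongrightarrow> a"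
  shows "sa_square a"
proof -
  obtain t where t: "\<And>n. norm (X n) \<le> t"
    using convergent_imp_Bseq[OF convergentI[OF X(2)]] unfolding Bseq_def by blast
  have "(\<lambda>n. star (X n)) \<longlonglongrightarrow> star a"
    by (rule bounded_linear.tendsto[OF bounded_linear_star X(2)])
  then have "X \<longlonglongrightarrow> star a"
    by (simp add: sa_square_self_adjoint[OF X(1)])
  then have "star a = a"
    using X(2) by (rule LIMSEQ_unique)
  moreover have "(\<lambda>n. norm (t *\<^sub>R 1 - X n)) \<longlonglongrightarrow> norm (t *\<^sub>R 1 - a)"
    by (intro tendsto_norm tendsto_diff tendsto_const X(2))
  then have "norm (t *\<^sub>R 1 - a) \<le> t"
    by (rule LIMSEQ_le_const2) (use sa_square_norm_diff[OF X(1) t] in blast)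
  ultimately show ?thesis
    unfolding sa_square_iff by blast
qed

section \<open>Adjoining a unit\<close>

text \<open>The pair \<open>(\<lambda>, a)\<close> stands for \<open>\<lambda> 1 + a\<close>. Its norm is the larger one of \<open>\<bar>\<lambda>\<bar>\<close> and the operator
  norm of \<open>x \<mapsto> \<lambda> x + a x\<close>. The operator norm alone is only a seminorm when the algebra already has a
  unit; the maximum is definite in every case and still satisfies the C*-identity. It also gives
  the unit norm one over the zero algebra.\<close>
datatype 'a unitization = Unitization (scalar_part: complex) (algebra_part: 'a)

instantiation unitization :: (cstar_algebra) ring_1
begin

definition "0 = Unitization 0 0"
definition "1 = Unitization 1 0"
definition "u + v = Unitization (scalar_part u + scalar_part v) (algebra_part u + algebra_part v)"
definition "u - v = Unitization (scalar_part u - scalar_part v) (algebra_part u - algebra_part v)"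
definition "- u = Unitization (- scalar_part u) (- algebra_part u)"
definition "u * v = Unitization (scalar_part u * scalar_part v)
  (scaleC (scalar_part u) (algebra_part v) + scaleC (scalar_part v) (algebra_part u)
    + algebra_part u * algebra_part v)"

lemmas ring_defs = zero_unitization_def one_unitization_def plus_unitization_def
  minus_unitization_def uminus_unitization_def times_unitization_def

instance
  by standard
    (simp_all add: ring_defs algebra_simps scaleC_add_left scaleC_add_right scaleC_mult_left
      scaleC_mult_right scaleC_scaleC)

end

lemma unitization_part_simps [simp]:
  "scalar_part 0 = 0" "scalar_part 1 = 1" "scalar_part (u + v) = scalar_part u + scalar_part v"
  "scalar_part (u - v) = scalar_part u - scalar_part v" "scalar_part (- u) = - scalar_part u"
  "scalar_part (u * v) = scalar_part u * scalar_part v"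
  "algebra_part 0 = 0" "algebra_part 1 = 0" "algebra_part (u + v) = algebra_part u + algebra_part v"
  "algebra_part (u - v) = algebra_part u - algebra_part v" "algebra_part (- u) = - algebra_part u"
  "algebra_part (u * v) = scaleC (scalar_part u) (algebra_part v)
    + scaleC (scalar_part v) (algebra_part u) + algebra_part u * algebra_part v"
  by (simp_all add: ring_defs)

definition left_mult :: "'a::cstar_algebra unitization \<Rightarrow> 'a \<Rightarrow> 'a"
  where "left_mult u x = scaleC (scalar_part u) x + algebra_part u * x"

lemma bounded_linear_left_mult: "bounded_linear (left_mult u)"
  unfolding left_mult_def
  by (intro bounded_linear_add bounded_linear_scaleC bounded_linear_mult_right)

lemma left_mult_mult: "left_mult (u * v) = left_mult u \<circ> left_mult v"
  by (simp add: left_mult_def fun_eq_iff algebra_simps scaleC_add_right scaleC_mult_left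
      scaleC_mult_right scaleC_scaleC mult.commute)

lemma left_mult_add: "left_mult (u + v) = (\<lambda>x. left_mult u x + left_mult v x)"
  by (simp add: left_mult_def fun_eq_iff algebra_simps scaleC_add_left)

lemma left_mult_one: "left_mult 1 = (\<lambda>x. x)"
  by (simp add: left_mult_def fun_eq_iff)

lemma norm_left_mult_le: "norm (left_mult u x) \<le> onorm (left_mult u) * norm x"
  by (rule onorm[OF bounded_linear_left_mult])

lemma onorm_left_mult_le: "onorm (left_mult u) \<le> cmod (scalar_part u) + norm (algebra_part u)"
proof (rule onorm_bound)
  show "norm (left_mult u x) \<le> (cmod (scalar_part u) + norm (algebra_part u)) * norm x" for x
    unfolding left_mult_def distrib_right
    by (rule norm_triangle_le) (intro add_mono norm_mult_ineq, simp add: norm_scaleC)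
qed simp

text \<open>Evaluate \<open>x \<mapsto> \<lambda> x + a x\<close> at \<open>x = a\<^sup>*\<close>. The bound makes the norm definite and
  equivalent to the product norm, so that completeness is inherited.\<close>
lemma norm_algebra_part_le:
  "norm (algebra_part u) \<le> cmod (scalar_part u) + onorm (left_mult u)"
proof -
  define a where "a = algebra_part u"
  have "(norm a)\<^sup>2 = norm (a * star a)"
    using cstar_identity[of "star a"] by (simp add: star_star)
  also have "a * star a = left_mult u (star a) - scaleC (scalar_part u) (star a)"
    by (simp add: left_mult_def a_def)
  also have "norm \<dots> \<le> norm (left_mult u (star a)) + norm (scaleC (scalar_part u) (star a))"
    by (rule norm_triangle_ineq4)
  also have "\<dots> \<le> onorm (left_mult u) * norm a + cmod (scalar_part u) * norm a"
    using norm_left_mult_le[of u "star a"] by (simp add: norm_scaleC)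
  finally have "norm a * norm a \<le> (cmod (scalar_part u) + onorm (left_mult u)) * norm a"
    by (simp add: power2_eq_square algebra_simps)
  moreover have "0 \<le> cmod (scalar_part u) + onorm (left_mult u)"
    by (simp add: onorm_pos_le[OF bounded_linear_left_mult])
  ultimately have "norm a \<le> cmod (scalar_part u) + onorm (left_mult u)"
    by (cases "norm a = 0") auto
  then show ?thesis
    by (simp add: a_def)
qed

instantiation unitization :: (cstar_algebra) real_algebra_1
begin

definition "r *\<^sub>R u = Unitization (of_real r * scalar_part u) (scaleC (of_real r) (algebra_part u))"

instance
  by standard
    (simp_all add: scaleR_unitization_def ring_defs scaleC_add_left scaleC_add_right scaleC_scaleC
      scaleC_mult_left scaleC_mult_right algebra_simps)

end

instantiation unitization :: (cstar_algebra) real_normed_algebra_1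
begin

definition "norm u = max (cmod (scalar_part u)) (onorm (left_mult u))"
definition "dist (u :: 'a unitization) v = norm (u - v)"
definition "sgn (u :: 'a unitization) = u /\<^sub>R norm u"
definition "(uniformity :: ('a unitization \<times> 'a unitization) filter)
  = (INF e\<in>{0<..}. principal {(u, v). dist u v < e})"
definition "open (U :: 'a unitization set)
  \<longleftrightarrow> (\<forall>u\<in>U. eventually (\<lambda>(u', v). u' = u \<longrightarrow> v \<in> U) uniformity)"

instance
proof
  fix u v :: "'a unitization" and r :: real
  show "norm u = 0 \<longleftrightarrow> u = 0"
  proof
    assume "norm u = 0"
    then have "cmod (scalar_part u) \<le> 0" "onorm (left_mult u) \<le> 0"
      unfolding norm_unitization_def by linarith+
    moreover from this have "norm (algebra_part u) \<le> 0"
      using norm_algebra_part_le[of u] by linarith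
    ultimately show "u = 0"
      by (simp add: unitization.expand)
  next
    assume "u = 0"
    then show "norm u = 0"
      using onorm_left_mult_le[of u] onorm_pos_le[OF bounded_linear_left_mult[of u]]
      by (simp add: norm_unitization_def)
  qed
  show "norm (u + v) \<le> norm u + norm v"
    using norm_triangle_ineq[of "scalar_part u" "scalar_part v"]
      onorm_triangle[OF bounded_linear_left_mult[of u] bounded_linear_left_mult[of v]]
    unfolding norm_unitization_def left_mult_add by (simp, linarith)
  have "left_mult (r *\<^sub>R u) = (\<lambda>x. r *\<^sub>R left_mult u x)"
    by (simp add: left_mult_def scaleR_unitization_def fun_eq_iff scaleC_of_real[symmetric]
        scaleC_add_right scaleC_scaleC scaleC_mult_left)
  then show "norm (r *\<^sub>R u) = \<bar>r\<bar> * norm u"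
    using onorm_scaleR[OF bounded_linear_left_mult[of u], of r]
    by (simp add: norm_unitization_def max_mult_distrib_left,
      simp add: scaleR_unitization_def norm_mult)
  show "norm (u * v) \<le> norm u * norm v"
  proof -
    have "onorm (left_mult (u * v)) \<le> onorm (left_mult u) * onorm (left_mult v)"
      unfolding left_mult_mult by (intro onorm_compose bounded_linear_left_mult)
    also have "\<dots> \<le> norm u * norm v"
      by (intro mult_mono) (auto simp: norm_unitization_def le_max_iff_disj
          onorm_pos_le[OF bounded_linear_left_mult])
    finally have "onorm (left_mult (u * v)) \<le> norm u * norm v" .
    moreover have "cmod (scalar_part u) * cmod (scalar_part v) \<le> norm u * norm v"
      by (intro mult_mono) (auto simp: norm_unitization_def le_max_iff_disj)
    ultimately show ?thesis
      by (simp add: norm_unitization_def[of "u * v"] norm_mult)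
  qed
  show "norm (1 :: 'a unitization) = 1"
    using onorm_id_le[where 'a = 'a] by (simp add: norm_unitization_def left_mult_one)
qed (simp_all add: dist_unitization_def sgn_unitization_def uniformity_unitization_def
      open_unitization_def)

end

lemma norm_scalar_part_le: "cmod (scalar_part u) \<le> norm u"
  by (simp add: norm_unitization_def)

lemma norm_algebra_part_le_norm: "norm (algebra_part u) \<le> 2 * norm u"
  using norm_algebra_part_le[of u] by (simp add: norm_unitization_def)

lemma norm_unitization_le: "norm u \<le> cmod (scalar_part u) + norm (algebra_part u)"
  using onorm_left_mult_le[of u] by (simp add: norm_unitization_def)

instance unitization :: (cstar_algebra) banach
proof
  fix X :: "nat \<Rightarrow> 'a unitization"
  assume X: "Cauchy X"
  have "Cauchy (\<lambda>n. scalar_part (X n))"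
  proof (rule CauchyI)
    fix e :: real assume "0 < e"
    then obtain N where N: "\<And>m n. \<lbrakk>N \<le> m; N \<le> n\<rbrakk> \<Longrightarrow> norm (X m - X n) < e"
      using X by (metis CauchyD)
    have "norm (scalar_part (X m) - scalar_part (X n)) < e" if "N \<le> m" "N \<le> n" for m n
      using N[OF that] norm_scalar_part_le[of "X m - X n"] by simp
    then show "\<exists>N. \<forall>m\<ge>N. \<forall>n\<ge>N. norm (scalar_part (X m) - scalar_part (X n)) < e"
      by blast
  qed
  then obtain l where l: "(\<lambda>n. scalar_part (X n)) \<longlonglongrightarrow> l"
    by (auto dest: Cauchy_convergent convergentD)
  have "Cauchy (\<lambda>n. algebra_part (X n))"
  proof (rule CauchyI)
    fix e :: real assume "0 < e"
    then obtain N where N: "\<And>m n. \<lbrakk>N \<le> m; N \<le> n\<rbrakk> \<Longrightarrow> norm (X m - X n) < e / 2"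
      using X by (metis CauchyD half_gt_zero)
    have "norm (algebra_part (X m) - algebra_part (X n)) < e" if "N \<le> m" "N \<le> n" for m n
      using N[OF that] norm_algebra_part_le_norm[of "X m - X n"] by simp
    then show "\<exists>N. \<forall>m\<ge>N. \<forall>n\<ge>N. norm (algebra_part (X m) - algebra_part (X n)) < e"
      by blast
  qed
  then obtain a where a: "(\<lambda>n. algebra_part (X n)) \<longlonglongrightarrow> a"
    by (auto dest: Cauchy_convergent convergentD)
  let ?e = "\<lambda>n. cmod (scalar_part (X n) - l) + norm (algebra_part (X n) - a)"
  have "?e \<longlonglongrightarrow> 0 + 0"
    by (intro tendsto_add tendsto_norm_zero LIM_zero l a)
  then have e: "?e \<longlonglongrightarrow> 0"
    by simp
  have "norm (X n - Unitization l a) \<le> ?e n" for n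
    using norm_unitization_le[of "X n - Unitization l a"] by simp
  then have "\<forall>\<^sub>F n in sequentially. norm (X n - Unitization l a) \<le> ?e n"
    by (rule always_eventually[OF allI])
  then have "(\<lambda>n. X n - Unitization l a) \<longlonglongrightarrow> 0"
    using e by (rule Lim_null_comparison)
  then have "X \<longlonglongrightarrow> Unitization l a"
    by (rule LIM_zero_cancel)
  then show "convergent X"
    by (rule convergentI)
qed

instantiation unitization :: (cstar_algebra) cstar_algebra
begin

definition "scaleC c u = Unitization (c * scalar_part u) (scaleC c (algebra_part u))"
definition "star u = Unitization (cnj (scalar_part u)) (star (algebra_part u))"

instance
proof
  fix u v :: "'a unitization" and c d :: complex and r :: real
  show "scaleC c (u + v) = scaleC c u + scaleC c v"
    "scaleC (c + d) u = scaleC c u + scaleC d u"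
    "scaleC c (scaleC d u) = scaleC (c * d) u"
    "scaleC c u * v = scaleC c (u * v)" "u * scaleC c v = scaleC c (u * v)"
    by (simp_all add: scaleC_unitization_def ring_defs scaleC_add_left scaleC_add_right
        scaleC_scaleC scaleC_mult_left scaleC_mult_right algebra_simps)
  show "scaleC (complex_of_real r) u = r *\<^sub>R u"
    by (simp add: scaleC_unitization_def scaleR_unitization_def)
  show "star (u + v) = star u + star v" "star (scaleC c u) = scaleC (cnj c) (star u)"
    "star (star u) = u"
    by (simp_all add: star_unitization_def scaleC_unitization_def ring_defs star_add star_scaleC
        star_star)
  have star_mult': "star (x * y) = star y * star x" for x y :: "'a unitization"
    by (simp add: star_unitization_def ring_defs star_add star_scaleC star_mult mult.commute add_ac)
  then show "star (u * v) = star v * star u" .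
  have "left_mult (scaleC c u) = (\<lambda>x. scaleC c (left_mult u x))"
    by (simp add: left_mult_def scaleC_unitization_def fun_eq_iff scaleC_add_right scaleC_scaleC
        scaleC_mult_left)
  moreover have "onorm (\<lambda>x. scaleC c (left_mult u x)) = cmod c * onorm (left_mult u)"
    using onorm_scaleR[OF bounded_linear_left_mult[of u], of "cmod c"]
    by (simp add: onorm_def norm_scaleC)
  ultimately show "norm (scaleC c u) = cmod c * norm u"
    by (simp add: norm_unitization_def max_mult_distrib_left,
      simp add: scaleC_unitization_def norm_mult)
  \<comment> \<open>The C*-identity for operators: \<open>\<parallel>T y\<parallel>\<^sup>2 = \<parallel>(T y)\<^sup>* (T y)\<parallel> = \<parallel>y\<^sup>* (T\<^sup>* T y)\<parallel>\<close>.\<close>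
  have sq: "(onorm (left_mult x))\<^sup>2 \<le> onorm (left_mult (star x * x))" for x :: "'a unitization"
  proof -
    have "onorm (left_mult x) \<le> sqrt (onorm (left_mult (star x * x)))"
    proof (rule onorm_bound)
      show "0 \<le> sqrt (onorm (left_mult (star x * x)))"
        by (simp add: onorm_pos_le[OF bounded_linear_left_mult])
      fix y :: 'a
      have star_left: "star (left_mult x y) * z = star y * left_mult (star x) z" for z
        by (simp add: left_mult_def star_unitization_def star_add star_mult star_scaleC
            distrib_left distrib_right scaleC_mult_left scaleC_mult_right mult.assoc)
      have "(norm (left_mult x y))\<^sup>2 = norm (star y * left_mult (star x * x) y)"
        by (simp add: cstar_identity[symmetric] star_left left_mult_mult)
      also have "\<dots> \<le> norm y * (onorm (left_mult (star x * x)) * norm y)"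
        using norm_mult_ineq[of "star y" "left_mult (star x * x) y"]
          mult_left_mono[OF norm_left_mult_le[of "star x * x" y], of "norm y"] by simp
      finally have "(norm (left_mult x y))\<^sup>2 \<le> onorm (left_mult (star x * x)) * (norm y)\<^sup>2"
        by (simp add: power2_eq_square mult_ac)
      then show "norm (left_mult x y) \<le> sqrt (onorm (left_mult (star x * x))) * norm y"
        using real_le_rsqrt by (fastforce simp: real_sqrt_mult)
    qed
    then have "(onorm (left_mult x))\<^sup>2 \<le> (sqrt (onorm (left_mult (star x * x))))\<^sup>2"
      by (rule power_mono) (rule onorm_pos_le[OF bounded_linear_left_mult])
    then show ?thesis
      by (simp add: onorm_pos_le[OF bounded_linear_left_mult])
  qed
  have le: "onorm (left_mult (star x * x)) \<le> onorm (left_mult (star x)) * onorm (left_mult x)"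
    for x :: "'a unitization"
    unfolding left_mult_mult by (intro onorm_compose bounded_linear_left_mult)
  have pos: "0 \<le> onorm (left_mult x)" for x :: "'a unitization"
    by (rule onorm_pos_le[OF bounded_linear_left_mult])
  have star_le: "onorm (left_mult x) \<le> onorm (left_mult (star x))" for x :: "'a unitization"
  proof (cases "onorm (left_mult x) = 0")
    case False
    then show ?thesis
      using order_trans[OF sq le, of x] pos[of x] by (simp add: power2_eq_square)
  qed (simp add: pos)
  have "onorm (left_mult (star u)) = onorm (left_mult u)"
    using star_le[of u] star_le[of "star u"] \<open>star (star u) = u\<close> by simp
  then have eq: "onorm (left_mult (star u * u)) = (onorm (left_mult u))\<^sup>2"
    using sq[of u] le[of u] by (simp add: power2_eq_square)
  have max_sq: "max (a\<^sup>2) (b\<^sup>2) = (max a b)\<^sup>2" if "0 \<le> a" "0 \<le> b" for a b :: real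
    using that by (auto simp: max_def power2_le_iff_abs_le abs_le_square_iff[symmetric])
  have "cmod (scalar_part (star u * u)) = (cmod (scalar_part u))\<^sup>2"
    by (simp add: star_unitization_def norm_mult power2_eq_square)
  then show "norm (star u * u) = (norm u)\<^sup>2"
    using max_sq[OF norm_ge_zero pos] eq by (simp add: norm_unitization_def)
qed

end

definition embed :: "'a::cstar_algebra \<Rightarrow> 'a unitization"
  where "embed a = Unitization 0 a"

lemma embed_add: "embed (a + b) = embed a + embed b"
  and embed_diff: "embed (a - b) = embed a - embed b"
  and embed_mult: "embed (a * b) = embed a * embed b"
  and embed_scaleR: "embed (r *\<^sub>R a) = r *\<^sub>R embed a"
  and embed_star: "embed (star a) = star (embed a)"
  by (simp_all add: embed_def ring_defs scaleR_unitization_def star_unitization_def scaleC_of_real)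

lemma norm_embed [simp]: "norm (embed a) = norm a"
proof (rule antisym)
  show "norm (embed a) \<le> norm a"
    using norm_unitization_le[of "embed a"] by (simp add: embed_def)
  show "norm a \<le> norm (embed a)"
    using norm_algebra_part_le[of "embed a"] by (simp add: embed_def norm_unitization_def)
qed

lemma bounded_linear_embed: "bounded_linear embed"
  by (rule bounded_linear_intro[where K = 1]) (simp_all add: embed_add embed_scaleR)

text \<open>If \<open>(0, a) = c\<^sup>* c\<close> in the unitization, then the scalar part of \<open>c\<close> vanishes, so the
  factorization already takes place in the algebra.\<close>
lemma cstar_nonneg_iff_embed: "cstar_nonneg a \<longleftrightarrow> sa_square (embed a)"
proof
  assume "cstar_nonneg a"
  then show "sa_square (embed a)"
    by (auto simp: cstar_nonneg_def embed_mult embed_star star_mult_self_is_sa_square)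
next
  assume "sa_square (embed a)"
  then obtain c where c: "star c = c" "embed a = c * c"
    unfolding sa_square_def by blast
  from arg_cong[OF c(2), of scalar_part] have "scalar_part c = 0"
    by (simp add: embed_def)
  with arg_cong[OF c(2), of algebra_part] arg_cong[OF c(1), of algebra_part]
  have "a = star (algebra_part c) * algebra_part c"
    by (simp add: embed_def star_unitization_def)
  then show "cstar_nonneg a"
    unfolding cstar_nonneg_def by blast
qed

section \<open>The positive cone of a C*-algebra\<close>

lemma cstar_nonneg_LIMSEQ:
  fixes a :: "'a::cstar_algebra"
  assumes "\<And>n. cstar_nonneg (X n)" "X \<longlonglongrightarrow> a"
  shows "cstar_nonneg a"
  unfolding cstar_nonneg_iff_embed
  by (rule sa_square_LIMSEQ[OF _ bounded_linear.tendsto[OF bounded_linear_embed assms(2)]])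
    (simp add: assms(1) flip: cstar_nonneg_iff_embed)

text \<open>The algebraic core of the Cauchy--Schwarz inequality, for \<open>g = \<langle>x, x\<rangle>\<close>, \<open>a = \<langle>x, y\<rangle>\<close> and
  \<open>h = \<langle>y, y\<rangle>\<close>: the assumption is positivity of the inner square of \<open>y - x (r a)\<close>. With \<open>r = 1 / t\<close> and
  \<open>a\<^sup>* g a \<le> t a\<^sup>* a\<close> it gives \<open>a\<^sup>* a / t \<le> h\<close>, hence the bound with \<open>t\<close> in place of \<open>\<parallel>g\<parallel>\<close>. Letting
  \<open>t\<close> decrease to \<open>\<parallel>g\<parallel>\<close> covers \<open>g = 0\<close> as well.\<close>
lemma cauchy_schwarz_cstar:
  fixes g h a :: "'a::cstar_algebra"
  assumes g: "star g = g"
    and pos: "\<And>r. cstar_nonneg (h - (2 * r) *\<^sub>R (star a * a) + r\<^sup>2 *\<^sub>R (star a * g * a))"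
  shows "(norm a)\<^sup>2 \<le> norm g * norm h"
proof -
  have bound: "(norm a)\<^sup>2 \<le> t * norm h" if t: "0 < t" "norm g \<le> t" for t
  proof -
    let ?a = "embed a" and ?g = "embed g" and ?h = "embed h"
    define q where "q = ?h - (2 / t) *\<^sub>R (star ?a * ?a) + (1 / t)\<^sup>2 *\<^sub>R (star ?a * ?g * ?a)"
    have "sa_square q"
      using pos[of "1 / t"]
      by (simp add: cstar_nonneg_iff_embed q_def embed_add embed_diff embed_mult embed_scaleR embed_star)
    have "star ?g = ?g"
      by (simp add: g flip: embed_star)
    then have "sa_square (t *\<^sub>R 1 - ?g)"
      using t by (intro sa_square_of_real_diff) auto
    then obtain w where w: "star w = w" "w * w = t *\<^sub>R 1 - ?g"
      unfolding sa_square_def by metis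
    \<comment> \<open>\<open>a\<^sup>* (t - g) a = (w a)\<^sup>* (w a)\<close> for the square root \<open>w\<close> of \<open>t - g\<close>.\<close>
    have "sa_square (star (w * ?a) * (w * ?a))"
      by (rule star_mult_self_is_sa_square)
    also have "star (w * ?a) * (w * ?a) = star ?a * (w * w) * ?a"
      by (simp add: star_mult w(1) mult.assoc)
    also have "\<dots> = t *\<^sub>R (star ?a * ?a) - star ?a * ?g * ?a"
      by (simp add: w(2) algebra_simps)
    finally have "sa_square (q + (1 / t)\<^sup>2 *\<^sub>R (t *\<^sub>R (star ?a * ?a) - star ?a * ?g * ?a))"
      using \<open>sa_square q\<close> by (intro sa_square_add sa_square_scaleR) auto
    also have "q + (1 / t)\<^sup>2 *\<^sub>R (t *\<^sub>R (star ?a * ?a) - star ?a * ?g * ?a) = ?h - (1 / t) *\<^sub>R (star ?a * ?a)"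
    proof -
      have "(1 / t)\<^sup>2 *\<^sub>R (t *\<^sub>R (star ?a * ?a)) = (1 / t) *\<^sub>R (star ?a * ?a)"
        using t by (simp add: power2_eq_square)
      moreover have "(2 / t) *\<^sub>R (star ?a * ?a) = (1 / t) *\<^sub>R (star ?a * ?a) + (1 / t) *\<^sub>R (star ?a * ?a)"
        by (simp flip: scaleR_add_left)
      ultimately show ?thesis
        by (simp add: q_def scaleR_diff_right)
    qed
    finally have "norm ((1 / t) *\<^sub>R (star ?a * ?a)) \<le> norm ?h"
      using sa_square_norm_mono[of "(1 / t) *\<^sub>R (star ?a * ?a)" "?h - (1 / t) *\<^sub>R (star ?a * ?a)"] t
      by (simp add: sa_square_scaleR star_mult_self_is_sa_square)
    then show ?thesis
      using t by (simp add: cstar_identity divide_simps mult.commute)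
  qed
  have "((\<lambda>e. (norm g + e) * norm h) \<longlongrightarrow> (norm g + 0) * norm h) (at_right 0)"
    by (intro tendsto_intros)
  then have "(norm a)\<^sup>2 \<le> (norm g + 0) * norm h"
    by (rule tendsto_lowerbound)
      (use bound[of "norm g + _"] in \<open>auto simp: eventually_at_filter add_nonneg_pos\<close>)
  then show ?thesis
    by simp
qed


section \<open>Semi-inner-product modules\<close>

text \<open>Dropping definiteness and completeness covers the three modules below at once: the given one,
  the families of finite support, and the module of functions before its completeness is known.\<close>
locale semi_inner_module = right_cstar_module smul act
  for smul :: "complex \<Rightarrow> 'm::ab_group_add \<Rightarrow> 'm"
    and act :: "'m \<Rightarrow> 'a::cstar_algebra \<Rightarrow> 'm" +
  fixes M :: "'m set"
    and ip :: "'m \<Rightarrow> 'm \<Rightarrow> 'a"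
  assumes submodule: "act_submodule smul act M"
    and ip_add_right: "\<lbrakk>x \<in> M; y \<in> M; z \<in> M\<rbrakk> \<Longrightarrow> ip x (y + z) = ip x y + ip x z"
    and ip_scale_right: "\<lbrakk>x \<in> M; y \<in> M\<rbrakk> \<Longrightarrow> ip x (smul c y) = scaleC c (ip x y)"
    and ip_act_right: "\<lbrakk>x \<in> M; y \<in> M\<rbrakk> \<Longrightarrow> ip x (act y a) = ip x y * a"
    and ip_star: "\<lbrakk>x \<in> M; y \<in> M\<rbrakk> \<Longrightarrow> ip y x = star (ip x y)"
    and ip_nonneg: "x \<in> M \<Longrightarrow> cstar_nonneg (ip x x)"
begin

lemma subspace_M: "subspace M"
  using submodule by (simp add: act_submodule_def)

lemma closed_M [simp]:
  "0 \<in> M" "\<lbrakk>x \<in> M; y \<in> M\<rbrakk> \<Longrightarrow> x + y \<in> M" "\<lbrakk>x \<in> M; y \<in> M\<rbrakk> \<Longrightarrow> x - y \<in> M"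
  "x \<in> M \<Longrightarrow> - x \<in> M" "x \<in> M \<Longrightarrow> smul c x \<in> M" "x \<in> M \<Longrightarrow> act x a \<in> M"
  using submodule subspace_M
  by (auto simp: act_submodule_def subspace_0 subspace_add subspace_diff subspace_neg subspace_scale)

lemma sum_closed_M: "(\<And>i. i \<in> I \<Longrightarrow> f i \<in> M) \<Longrightarrow> sum f I \<in> M"
  using subspace_M by (rule subspace_sum)

lemma ip_zero_right [simp]: "x \<in> M \<Longrightarrow> ip x 0 = 0"
  using ip_add_right[of x 0 0] by simp

lemma ip_minus_right: "\<lbrakk>x \<in> M; y \<in> M\<rbrakk> \<Longrightarrow> ip x (- y) = - ip x y"
  using ip_add_right[of x y "- y"] by (simp add: eq_neg_iff_add_eq_0 add.commute)

lemma ip_diff_right: "\<lbrakk>x \<in> M; y \<in> M; z \<in> M\<rbrakk> \<Longrightarrow> ip x (y - z) = ip x y - ip x z"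
  using ip_add_right[of x y "- z"] by (simp add: ip_minus_right)

lemma ip_add_left:
  assumes "x \<in> M" "y \<in> M" "z \<in> M"
  shows "ip (x + y) z = ip x z + ip y z"
  using assms ip_star[of z "x + y"] by (simp add: ip_add_right star_add flip: ip_star)

lemma ip_diff_left:
  assumes "x \<in> M" "y \<in> M" "z \<in> M"
  shows "ip (x - y) z = ip x z - ip y z"
  using assms ip_star[of z "x - y"] by (simp add: ip_diff_right star_diff flip: ip_star)

lemma ip_zero_left [simp]: "x \<in> M \<Longrightarrow> ip 0 x = 0"
  using ip_star[of x 0] by simp

lemma ip_scale_left:
  assumes "x \<in> M" "y \<in> M"
  shows "ip (smul c x) y = scaleC (cnj c) (ip x y)"
  using assms ip_star[of y "smul c x"] by (simp add: ip_scale_right star_scaleC flip: ip_star)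

lemma ip_act_left:
  assumes "x \<in> M" "y \<in> M"
  shows "ip (act x a) y = star a * ip x y"
  using assms ip_star[of y "act x a"] by (simp add: ip_act_right star_mult flip: ip_star)

lemma ip_sum_right: "\<lbrakk>x \<in> M; \<And>i. i \<in> I \<Longrightarrow> f i \<in> M\<rbrakk> \<Longrightarrow> ip x (sum f I) = (\<Sum>i\<in>I. ip x (f i))"
  by (induction I rule: infinite_finite_induct) (simp_all add: ip_add_right sum_closed_M)

lemma ip_sum_left: "\<lbrakk>x \<in> M; \<And>i. i \<in> I \<Longrightarrow> f i \<in> M\<rbrakk> \<Longrightarrow> ip (sum f I) x = (\<Sum>i\<in>I. ip (f i) x)"
  by (induction I rule: infinite_finite_induct) (simp_all add: ip_add_left sum_closed_M)

definition vnorm :: "'m \<Rightarrow> real"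
  where "vnorm x = sqrt (norm (ip x x))"

lemma vnorm_nonneg [simp]: "0 \<le> vnorm x"
  by (simp add: vnorm_def)

lemma vnorm_sq: "(vnorm x)\<^sup>2 = norm (ip x x)"
  by (simp add: vnorm_def)

lemma vnorm_zero [simp]: "vnorm 0 = 0"
  by (simp add: vnorm_def)

lemma Cauchy_Schwarz:
  assumes x: "x \<in> M" and y: "y \<in> M"
  shows "norm (ip x y) \<le> vnorm x * vnorm y"
proof -
  define a where "a = ip x y"
  have "star (ip x x) = ip x x"
    by (rule ip_star[OF x x, symmetric])
  moreover have "cstar_nonneg (ip y y - (2 * r) *\<^sub>R (star a * a) + r\<^sup>2 *\<^sub>R (star a * ip x x * a))" for r
  proof -
    define z where "z = act x (r *\<^sub>R a)"
    have z: "z \<in> M"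
      by (simp add: z_def x)
    have "ip y z = r *\<^sub>R (star a * a)"
      by (simp add: z_def ip_act_right x y a_def flip: ip_star[OF x y])
    moreover have "ip z y = r *\<^sub>R (star a * a)"
      by (simp add: z_def ip_act_left x y star_scaleR, simp add: a_def)
    moreover have "ip z z = r\<^sup>2 *\<^sub>R (star a * ip x x * a)"
      by (simp add: z_def ip_act_left ip_act_right x star_scaleR power2_eq_square mult.assoc)
    moreover have "ip (y - z) (y - z) = ip y y - ip y z - ip z y + ip z z"
      by (simp add: ip_diff_left ip_diff_right y z)
    ultimately have "ip (y - z) (y - z) = ip y y - (2 * r) *\<^sub>R (star a * a) + r\<^sup>2 *\<^sub>R (star a * ip x x * a)"
      by (simp only: mult_2 scaleR_add_left diff_diff_eq)
    then show ?thesis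
      using ip_nonneg[of "y - z"] y z by simp
  qed
  ultimately have "(norm a)\<^sup>2 \<le> norm (ip x x) * norm (ip y y)"
    by (rule cauchy_schwarz_cstar)
  then have "(norm a)\<^sup>2 \<le> (vnorm x * vnorm y)\<^sup>2"
    by (simp add: power_mult_distrib vnorm_sq)
  then show ?thesis
    unfolding a_def by (rule power2_le_imp_le) simp
qed

lemma vnorm_triangle:
  assumes "x \<in> M" "y \<in> M"
  shows "vnorm (x + y) \<le> vnorm x + vnorm y"
proof -
  have "(vnorm (x + y))\<^sup>2 = norm (ip x x + ip x y + (ip y x + ip y y))"
    by (simp add: vnorm_sq ip_add_left ip_add_right assms add_ac)
  also have "\<dots> \<le> norm (ip x x) + norm (ip x y) + (norm (ip y x) + norm (ip y y))"
    by (intro order_trans[OF norm_triangle_ineq] add_mono) auto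
  also have "\<dots> \<le> (vnorm x)\<^sup>2 + vnorm x * vnorm y + (vnorm y * vnorm x + (vnorm y)\<^sup>2)"
    unfolding vnorm_sq by (intro add_mono Cauchy_Schwarz assms order_refl)
  also have "\<dots> = (vnorm x + vnorm y)\<^sup>2"
    by (simp add: power2_sum)
  finally show ?thesis
    by (rule power2_le_imp_le) simp
qed

lemma vnorm_scale: "x \<in> M \<Longrightarrow> vnorm (smul c x) = cmod c * vnorm x"
  by (simp add: vnorm_def ip_scale_left ip_scale_right norm_scaleC real_sqrt_mult)

lemma vnorm_minus [simp]: "x \<in> M \<Longrightarrow> vnorm (- x) = vnorm x"
  using vnorm_scale[of x "- 1"] by simp

lemma vnorm_diff_commute: "\<lbrakk>x \<in> M; y \<in> M\<rbrakk> \<Longrightarrow> vnorm (x - y) = vnorm (y - x)"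
  using vnorm_minus[of "x - y"] by simp

lemma vnorm_diff_triangle:
  "\<lbrakk>x \<in> M; y \<in> M; z \<in> M\<rbrakk> \<Longrightarrow> vnorm (x - z) \<le> vnorm (x - y) + vnorm (y - z)"
  using vnorm_triangle[of "x - y" "y - z"] by simp

lemma vnorm_le_add_diff: "\<lbrakk>x \<in> M; y \<in> M\<rbrakk> \<Longrightarrow> vnorm x \<le> vnorm y + vnorm (x - y)"
  using vnorm_triangle[of y "x - y"] by simp

lemma vnorm_act_le:
  assumes "x \<in> M"
  shows "vnorm (act x a) \<le> vnorm x * norm a"
proof -
  have "(vnorm (act x a))\<^sup>2 = norm (star a * ip x x * a)"
    by (simp add: vnorm_sq ip_act_left ip_act_right assms mult.assoc)
  also have "\<dots> \<le> norm (star a) * norm (ip x x) * norm a"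
    by (rule order_trans[OF norm_mult_ineq mult_right_mono[OF norm_mult_ineq]]) simp
  also have "\<dots> = (vnorm x * norm a)\<^sup>2"
    by (simp add: power_mult_distrib vnorm_sq, simp add: power2_eq_square)
  finally show ?thesis
    by (rule power2_le_imp_le) simp
qed

lemma norm_ip_diff_le:
  assumes "x \<in> M" "y \<in> M" "x' \<in> M" "y' \<in> M"
  shows "norm (ip x y - ip x' y') \<le> vnorm (x - x') * vnorm y + vnorm x' * vnorm (y - y')"
proof -
  have "ip x y - ip x' y' = ip (x - x') y + ip x' (y - y')"
    by (simp add: ip_diff_left ip_diff_right assms)
  then have "norm (ip x y - ip x' y') \<le> norm (ip (x - x') y) + norm (ip x' (y - y'))"
    by (simp add: norm_triangle_ineq)
  also have "\<dots> \<le> vnorm (x - x') * vnorm y + vnorm x' * vnorm (y - y')"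
    by (intro add_mono Cauchy_Schwarz) (simp_all add: assms)
  finally show ?thesis .
qed

definition vCauchy :: "(nat \<Rightarrow> 'm) \<Rightarrow> bool"
  where "vCauchy X \<longleftrightarrow> (\<forall>n. X n \<in> M) \<and> (\<forall>e>0. \<exists>N. \<forall>m\<ge>N. \<forall>n\<ge>N. vnorm (X m - X n) < e)"

lemma vCauchy_mem: "vCauchy X \<Longrightarrow> X n \<in> M"
  by (simp add: vCauchy_def)

lemma vCauchyD: "\<lbrakk>vCauchy X; 0 < e\<rbrakk> \<Longrightarrow> \<exists>N. \<forall>m\<ge>N. \<forall>n\<ge>N. vnorm (X m - X n) < e"
  by (simp add: vCauchy_def)

lemma vCauchy_bounded:
  assumes "vCauchy X"
  obtains B where "0 < B" "\<And>n. vnorm (X n) \<le> B"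
proof -
  obtain N where N: "\<And>m n. \<lbrakk>N \<le> m; N \<le> n\<rbrakk> \<Longrightarrow> vnorm (X m - X n) < 1"
    using vCauchyD[OF assms, of 1] by auto
  define B where "B = 1 + (\<Sum>n\<le>N. vnorm (X n))"
  have le: "vnorm (X n) \<le> (\<Sum>n\<le>N. vnorm (X n))" if "n \<le> N" for n
    using that by (intro member_le_sum) auto
  have "vnorm (X n) \<le> B" for n
  proof (cases "n \<le> N")
    case False
    then show ?thesis
      using N[of n N] vnorm_le_add_diff[of "X n" "X N"] le[of N] vCauchy_mem[OF assms]
      by (simp add: B_def)
  qed (use le in \<open>fastforce simp: B_def\<close>)
  moreover have "0 < B"
    by (simp add: B_def add_pos_nonneg sum_nonneg)
  ultimately show ?thesis
    using that by blast
qed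

lemma vCauchy_const: "x \<in> M \<Longrightarrow> vCauchy (\<lambda>_. x)"
  by (simp add: vCauchy_def)

lemma vCauchy_add:
  assumes "vCauchy X" "vCauchy Y"
  shows "vCauchy (\<lambda>n. X n + Y n)"
proof -
  have "\<exists>N. \<forall>m\<ge>N. \<forall>n\<ge>N. vnorm (X m + Y m - (X n + Y n)) < e" if "0 < e" for e
  proof -
    have "0 < e / 2"
      using that by simp
    then obtain N1 N2 where N: "\<forall>m\<ge>N1. \<forall>n\<ge>N1. vnorm (X m - X n) < e / 2"
        "\<forall>m\<ge>N2. \<forall>n\<ge>N2. vnorm (Y m - Y n) < e / 2"
      using vCauchyD[OF assms(1)] vCauchyD[OF assms(2)] by presburger
    have "vnorm (X m + Y m - (X n + Y n)) < e" if "max N1 N2 \<le> m" "max N1 N2 \<le> n" for m n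
    proof -
      have "vnorm ((X m - X n) + (Y m - Y n)) \<le> vnorm (X m - X n) + vnorm (Y m - Y n)"
        using assms by (intro vnorm_triangle) (simp_all add: vCauchy_mem)
      moreover have "vnorm (X m - X n) < e / 2" "vnorm (Y m - Y n) < e / 2"
        using N that by simp_all
      ultimately have "vnorm ((X m - X n) + (Y m - Y n)) < e"
        by linarith
      then show ?thesis
        by (simp only: add_diff_add)
    qed
    then show ?thesis
      by blast
  qed
  then show ?thesis
    using assms by (simp add: vCauchy_def)
qed

text \<open>Serves for the two module operations, which are bounded additive maps.\<close>
lemma vCauchy_image:
  assumes X: "vCauchy X" and f: "\<And>x. x \<in> M \<Longrightarrow> f x \<in> M"
    and diff: "\<And>x y. \<lbrakk>x \<in> M; y \<in> M\<rbrakk> \<Longrightarrow> f x - f y = f (x - y)"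
    and bound: "\<And>x. x \<in> M \<Longrightarrow> vnorm (f x) \<le> C * vnorm x"
  shows "vCauchy (\<lambda>n. f (X n))"
proof -
  have "\<exists>N. \<forall>m\<ge>N. \<forall>n\<ge>N. vnorm (f (X m) - f (X n)) < e" if "0 < e" for e
  proof -
    have "0 < e / (\<bar>C\<bar> + 1)"
      using that by simp
    then obtain N where N: "\<And>m n. \<lbrakk>N \<le> m; N \<le> n\<rbrakk> \<Longrightarrow> vnorm (X m - X n) < e / (\<bar>C\<bar> + 1)"
      using vCauchyD[OF X] by blast
    have "vnorm (f (X m) - f (X n)) < e" if "N \<le> m" "N \<le> n" for m n
    proof -
      have "vnorm (f (X m) - f (X n)) \<le> C * vnorm (X m - X n)"
        using X by (simp add: diff bound vCauchy_mem)
      also have "\<dots> \<le> (\<bar>C\<bar> + 1) * vnorm (X m - X n)"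
        by (intro mult_right_mono) auto
      also have "\<dots> < e"
        using N[OF that] by (simp add: pos_less_divide_eq mult.commute add_nonneg_pos)
      finally show ?thesis .
    qed
    then show ?thesis
      by blast
  qed
  then show ?thesis
    using X by (simp add: vCauchy_def f)
qed

lemma vCauchy_scale: "vCauchy X \<Longrightarrow> vCauchy (\<lambda>n. smul c (X n))"
  by (erule vCauchy_image[where C = "cmod c"]) (simp_all add: scale_right_diff_distrib vnorm_scale)

lemma act_diff_left: "act (x - y) a = act x a - act y a"
  using act_add_left[of "x - y" y a] by simp

lemma vCauchy_act: "vCauchy X \<Longrightarrow> vCauchy (\<lambda>n. act (X n) a)"
  by (erule vCauchy_image[where C = "norm a"])
    (simp_all add: act_diff_left vnorm_act_le[simplified mult.commute])

lemma convergent_ip: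
  assumes X: "vCauchy X" and Y: "vCauchy Y"
  shows "convergent (\<lambda>n. ip (X n) (Y n))"
proof -
  obtain B C where B: "0 < B" "\<And>n. vnorm (X n) \<le> B" and C: "0 < C" "\<And>n. vnorm (Y n) \<le> C"
    using vCauchy_bounded[OF X] vCauchy_bounded[OF Y] by metis
  have "Cauchy (\<lambda>n. ip (X n) (Y n))"
  proof (rule CauchyI)
    fix e :: real assume e: "0 < e"
    have "0 < e / (2 * C)" "0 < e / (2 * B)"
      using B C e by simp_all
    then obtain N1 N2 where N: "\<forall>m\<ge>N1. \<forall>n\<ge>N1. vnorm (X m - X n) < e / (2 * C)"
        "\<forall>m\<ge>N2. \<forall>n\<ge>N2. vnorm (Y m - Y n) < e / (2 * B)"
      using vCauchyD[OF X] vCauchyD[OF Y] by presburger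
    have "norm (ip (X m) (Y m) - ip (X n) (Y n)) < e" if "max N1 N2 \<le> m" "max N1 N2 \<le> n" for m n
    proof -
      have "norm (ip (X m) (Y m) - ip (X n) (Y n))
          \<le> vnorm (X m - X n) * vnorm (Y m) + vnorm (X n) * vnorm (Y m - Y n)"
        using X Y by (intro norm_ip_diff_le) (simp_all add: vCauchy_mem)
      also have "\<dots> \<le> vnorm (X m - X n) * C + B * vnorm (Y m - Y n)"
        using B C by (intro add_mono mult_left_mono mult_right_mono) auto
      also have "\<dots> < e / (2 * C) * C + B * (e / (2 * B))"
        using that B(1) C(1) by (intro add_strict_mono mult_strict_right_mono mult_strict_left_mono N[rule_format]) auto
      also have "\<dots> = e"
        using B(1) C(1) by simp
      finally show ?thesis .
    qed
    then show "\<exists>N. \<forall>m\<ge>N. \<forall>n\<ge>N. norm (ip (X m) (Y m) - ip (X n) (Y n)) < e"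
      by blast
  qed
  then show ?thesis
    by (rule Cauchy_convergent)
qed

lemma LIMSEQ_ip_left:
  assumes X: "\<And>n. X n \<in> M" "x \<in> M" "(\<lambda>n. vnorm (X n - x)) \<longlonglongrightarrow> 0" and y: "y \<in> M"
  shows "(\<lambda>n. ip (X n) y) \<longlonglongrightarrow> ip x y"
proof (rule LIM_zero_cancel, rule Lim_null_comparison)
  show "\<forall>\<^sub>F n in sequentially. norm (ip (X n) y - ip x y) \<le> vnorm (X n - x) * vnorm y"
    using X y Cauchy_Schwarz[of "X _ - x" y] by (simp add: ip_diff_left)
  show "(\<lambda>n. vnorm (X n - x) * vnorm y) \<longlonglongrightarrow> 0"
    using tendsto_mult_right[OF X(3), of "vnorm y"] by simp
qed

end

locale inner_product_module = semi_inner_module +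
  assumes ip_definite: "\<lbrakk>x \<in> M; ip x x = 0\<rbrakk> \<Longrightarrow> x = 0"
begin

lemma ip_dist_eq: "\<lbrakk>x \<in> M; y \<in> M\<rbrakk> \<Longrightarrow> ip_dist M ip x y = vnorm (x - y)"
  by (simp add: ip_dist_def vnorm_def)

lemma vnorm_eq_0_iff: "x \<in> M \<Longrightarrow> vnorm x = 0 \<longleftrightarrow> x = 0"
  using ip_definite by (auto simp: vnorm_def)

lemma Metric_space_ip_dist: "Metric_space M (ip_dist M ip)"
proof
  show "0 \<le> ip_dist M ip x y" for x y
    by (simp add: ip_dist_def)
  show "ip_dist M ip x y = ip_dist M ip y x" for x y
    using vnorm_diff_commute by (auto simp: ip_dist_def simp flip: vnorm_def)
  show "ip_dist M ip x y = 0 \<longleftrightarrow> x = y" if "x \<in> M" "y \<in> M" for x y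
    using that by (simp add: ip_dist_eq vnorm_eq_0_iff)
  show "ip_dist M ip x z \<le> ip_dist M ip x y + ip_dist M ip y z" if "x \<in> M" "y \<in> M" "z \<in> M" for x y z
    using that by (simp add: ip_dist_eq vnorm_diff_triangle)
qed

lemma MCauchy_iff: "Metric_space.MCauchy M (ip_dist M ip) X \<longleftrightarrow> vCauchy X"
proof -
  have "(\<forall>e>0. \<exists>N. \<forall>n n'. N \<le> n \<longrightarrow> N \<le> n' \<longrightarrow> ip_dist M ip (X n) (X n') < e)
      \<longleftrightarrow> (\<forall>e>0. \<exists>N. \<forall>m\<ge>N. \<forall>n\<ge>N. vnorm (X m - X n) < e)" if "\<forall>n. X n \<in> M"
    using that by (simp add: ip_dist_eq)
  then show ?thesis
    unfolding Metric_space.MCauchy_def[OF Metric_space_ip_dist] vCauchy_def image_subset_iff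
    by (metis UNIV_I)
qed

lemma limitin_iff:
  assumes "\<And>n. X n \<in> M"
  shows "limitin (Metric_space.mtopology M (ip_dist M ip)) X x sequentially
    \<longleftrightarrow> x \<in> M \<and> (\<lambda>n. vnorm (X n - x)) \<longlonglongrightarrow> 0"
  unfolding Metric_space.limit_metric_sequentially[OF Metric_space_ip_dist]
  by (auto simp: assms ip_dist_eq lim_sequentially)

lemma mcomplete_iff:
  "Metric_space.mcomplete M (ip_dist M ip)
    \<longleftrightarrow> (\<forall>X. vCauchy X \<longrightarrow> (\<exists>x\<in>M. (\<lambda>n. vnorm (X n - x)) \<longlonglongrightarrow> 0))"
  unfolding Metric_space.mcomplete_def[OF Metric_space_ip_dist] MCauchy_iff
  by (metis limitin_iff vCauchy_mem)

lemma dense_in_module_iff: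
  "dense_in_module M ip X \<longleftrightarrow> X \<subseteq> M \<and> (\<forall>x\<in>M. \<forall>e>0. \<exists>y\<in>X. vnorm (x - y) < e)"
proof (cases "X \<subseteq> M")
  case True
  then have "(\<exists>y\<in>X. y \<in> Metric_space.mball M (ip_dist M ip) x e) \<longleftrightarrow> (\<exists>y\<in>X. vnorm (x - y) < e)"
    if "x \<in> M" for x e
    using that
    by (intro bex_cong) (auto simp: Metric_space.in_mball[OF Metric_space_ip_dist] ip_dist_eq)
  with True show ?thesis
    unfolding dense_in_module_def Metric_space.metric_closure_of[OF Metric_space_ip_dist]
    by blast
qed (simp add: dense_in_module_def)

end

sublocale hilbert_cstar_module \<subseteq> inner_product_module
  by unfold_locales (fact submodule ip_add_right ip_scale_right ip_act_right ip_star ip_nonneg ip_definite)+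

context hilbert_cstar_module
begin

lemma Cauchy_limit_exists:
  assumes "vCauchy X"
  obtains x where "x \<in> M" "(\<lambda>n. vnorm (X n - x)) \<longlonglongrightarrow> 0"
  using complete assms mcomplete_iff by blast

lemma ip_ext_left:
  assumes "x \<in> M" "y \<in> M" "\<And>z. z \<in> M \<Longrightarrow> ip x z = ip y z"
  shows "x = y"
  using ip_definite[of "x - y"] assms by (simp add: ip_diff_left)

lemma ip_ext_right:
  assumes "x \<in> M" "y \<in> M" "\<And>z. z \<in> M \<Longrightarrow> ip z x = ip z y"
  shows "x = y"
  using ip_definite[of "x - y"] assms by (simp add: ip_diff_right)

lemma limit_unique:
  assumes "\<And>n. X n \<in> M" "x \<in> M" "y \<in> M"
    "(\<lambda>n. vnorm (X n - x)) \<longlonglongrightarrow> 0" "(\<lambda>n. vnorm (X n - y)) \<longlonglongrightarrow> 0"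
  shows "x = y"
proof (rule ip_ext_left[OF assms(2,3)])
  fix z assume "z \<in> M"
  then show "ip x z = ip y z"
    using LIMSEQ_unique[OF LIMSEQ_ip_left[of X x z] LIMSEQ_ip_left[of X y z]] assms by blast
qed

text \<open>The set where \<open>\<parallel>T x\<parallel> \<le> n\<close> is closed, because \<open>\<parallel>T x\<parallel>\<^sup>2 = \<parallel>\<langle>x, T' T x\<rangle>\<parallel>\<close> is controlled by the
  functional \<open>\<langle>\<cdot>, T' T x\<rangle>\<close>, which is continuous. These sets exhaust the complete space, so by Baire's
  theorem one of them contains a ball; translating to the origin and scaling gives the bound.\<close>
lemma adjointable_imp_bounded:
  assumes T: "\<And>x. x \<in> M \<Longrightarrow> T x \<in> M" "\<And>x. x \<in> M \<Longrightarrow> T' x \<in> M"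
    and adj: "\<And>x y. \<lbrakk>x \<in> M; y \<in> M\<rbrakk> \<Longrightarrow> ip (T x) y = ip x (T' y)"
  obtains C where "0 \<le> C" "\<And>x. x \<in> M \<Longrightarrow> vnorm (T x) \<le> C * vnorm x"
proof -
  interpret Metric_space M "ip_dist M ip"
    by (rule Metric_space_ip_dist)
  have T_diff: "T (x - y) = T x - T y" if "x \<in> M" "y \<in> M" for x y
    using that by (intro ip_ext_left) (simp_all add: T adj ip_diff_left)
  have T_scale: "T (smul c x) = smul c (T x)" if "x \<in> M" for c x
    using that by (intro ip_ext_left) (simp_all add: T adj ip_scale_left)
  define F where "F n = {x \<in> M. vnorm (T x) \<le> real n}" for n
  have closed: "closedin mtopology (F n)" for n
    unfolding metric_closedin_iff_sequentially_closed
  proof (intro conjI allI impI)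
    show "F n \<subseteq> M"
      by (auto simp: F_def)
    fix X x
    assume X: "range X \<subseteq> F n \<and> limitin mtopology X x sequentially"
    then have XM: "X k \<in> M" and XF: "vnorm (T (X k)) \<le> real n" for k
      by (auto simp: F_def)
    have "limitin mtopology X x sequentially"
      using X by (rule conjunct2)
    then have x: "x \<in> M" and lim: "(\<lambda>n. vnorm (X n - x)) \<longlonglongrightarrow> 0"
      unfolding limitin_iff[OF XM] by simp_all
    have "(\<lambda>k. norm (ip (X k) (T' (T x)))) \<longlonglongrightarrow> norm (ip x (T' (T x)))"
      by (intro tendsto_norm LIMSEQ_ip_left XM x lim T)
    moreover have "norm (ip (X k) (T' (T x))) \<le> real n * vnorm (T x)" for k
    proof -
      have "norm (ip (X k) (T' (T x))) \<le> vnorm (T (X k)) * vnorm (T x)"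
        using Cauchy_Schwarz[of "T (X k)" "T x"] by (simp add: adj XM x T)
      also have "\<dots> \<le> real n * vnorm (T x)"
        by (intro mult_right_mono XF) simp
      finally show ?thesis .
    qed
    ultimately have "norm (ip x (T' (T x))) \<le> real n * vnorm (T x)"
      by (intro LIMSEQ_le_const2) auto
    then have "vnorm (T x) * vnorm (T x) \<le> real n * vnorm (T x)"
      using vnorm_sq[of "T x"] by (simp add: adj x T power2_eq_square)
    then have "vnorm (T x) \<le> real n"
      by (metis mult_right_le_imp_le order_le_less vnorm_nonneg of_nat_0_le_iff)
    with x show "x \<in> F n"
      by (simp add: F_def)
  qed
  have "\<exists>n. mtopology interior_of (F n) \<noteq> {}"
  proof (rule ccontr)
    assume "\<not> ?thesis"
    then have "\<And>A. A \<in> range F \<Longrightarrow> closedin mtopology A \<and> mtopology interior_of A = {}"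
      using closed by blast
    then have "mtopology interior_of \<Union> (range F) = {}"
      using complete by (intro metric_Baire_category_alt) simp_all
    moreover have "\<Union> (range F) = M"
      using real_arch_simple by (auto simp: F_def)
    ultimately have "M = {}"
      using interior_of_topspace[of mtopology] by simp
    then show False
      using closed_M(1) by blast
  qed
  then obtain n x r where x: "x \<in> M" and r: "0 < r" and ball: "mball x r \<subseteq> F n"
    unfolding metric_interior_of by blast
  have small: "vnorm (T z) \<le> 2 * real n" if z: "z \<in> M" "vnorm z < r" for z
  proof -
    have "x \<in> F n" "x - z \<in> F n"
      using x r z ball by (auto simp: ip_dist_eq subset_iff)
    moreover have "T z = T x - T (x - z)"
      using x z by (simp add: T_diff)
    ultimately show ?thesis
      using vnorm_triangle[of "T x" "- T (x - z)"] x z by (simp add: F_def T)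
  qed
  have "vnorm (T z) \<le> (4 * real n / r) * vnorm z" if z: "z \<in> M" for z
  proof (cases "z = 0")
    case True
    have "T 0 = 0"
      using T_diff[of 0 0] by simp
    with True show ?thesis by simp
  next
    case False
    then have pos: "0 < vnorm z"
      using vnorm_eq_0_iff[OF z] vnorm_nonneg[of z] by (simp add: order_le_less)
    define c where "c = r / (2 * vnorm z)"
    have c: "0 < c"
      using pos r by (simp add: c_def)
    have "c * vnorm z < r"
      using pos r by (simp add: c_def)
    then have "c * vnorm (T z) \<le> 2 * real n"
      using small[of "smul (complex_of_real c) z"] z c by (simp add: vnorm_scale T_scale T)
    then show ?thesis
      using pos r by (simp add: c_def divide_simps mult_ac)
  qed
  moreover have "0 \<le> 4 * real n / r"
    using r by simp
  ultimately show ?thesis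
    using that by blast
qed

end


section \<open>The reproducing kernel module\<close>

lemma act_submodule_sum:
  assumes "right_cstar_module smul act" "act_submodule smul act V" "\<And>i. i \<in> I \<Longrightarrow> f i \<in> V"
  shows "sum f I \<in> V"
proof -
  interpret right_cstar_module smul act by fact
  show ?thesis
    using assms(2,3) by (intro subspace_sum) (auto simp: act_submodule_def)
qed

lemma sum_fun_apply: "(\<Sum>i\<in>I. f i) t = (\<Sum>i\<in>I. f i t :: 'b::comm_monoid_add)"
  by (induction I rule: infinite_finite_induct) simp_all

lemma (in hilbert_cstar_module) adjoint_op_eq:
  assumes "z \<in> M" "\<And>x. x \<in> M \<Longrightarrow> ipN (T x) y = ip x z"
  shows "adjoint_op M ip ipN T y = z"
  unfolding adjoint_op_def using assms by (intro the_equality) (auto intro!: ip_ext_right)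

locale positive_kernel = E: hilbert_cstar_module smul act UNIV ip
  for smul :: "complex \<Rightarrow> 'e::ab_group_add \<Rightarrow> 'e"
    and act :: "'e \<Rightarrow> 'a::cstar_algebra \<Rightarrow> 'e"
    and ip :: "'e \<Rightarrow> 'e \<Rightarrow> 'a" +
  fixes K :: "'s \<Rightarrow> 's \<Rightarrow> 'e \<Rightarrow> 'e"
  assumes K_adjointable: "K s t \<in> adjointable_ops UNIV ip UNIV ip"
    and K_pos_def: "pos_def_kernel ip K"
begin

text \<open>The hermitian condition in a usable form: the adjoint of \<open>K s t\<close> exists since \<open>K s t\<close> is
  adjointable, and \<open>adjoint_op\<close> picks it out by uniqueness.\<close>
lemma ip_K_adjoint: "ip (K s t x) y = ip x (K t s y)"
proof -
  obtain T' where T': "\<And>x y. ip (K s t x) y = ip x (T' y)"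
    using K_adjointable[of s t] by (auto simp: adjointable_ops_def)
  have "K t s = adjoint_op UNIV ip ip (K s t)"
    using K_pos_def unfolding pos_def_kernel_def hermitian_kernel_def by blast
  then have "K t s y = adjoint_op UNIV ip ip (K s t) y"
    by (rule fun_cong)
  also have "\<dots> = T' y"
    by (rule E.adjoint_op_eq) (simp_all add: T')
  finally show ?thesis
    by (simp add: T')
qed

lemma K_add: "K s t (x + y) = K s t x + K s t y"
  by (rule E.ip_ext_left) (simp_all add: ip_K_adjoint E.ip_add_left)

lemma K_scale: "K s t (smul c x) = smul c (K s t x)"
  by (rule E.ip_ext_left) (simp_all add: ip_K_adjoint E.ip_scale_left)

lemma K_act: "K s t (act x a) = act (K s t x) a"
  by (rule E.ip_ext_left) (simp_all add: ip_K_adjoint E.ip_act_left)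

lemma K_zero [simp]: "K s t 0 = 0"
  using K_add[of s t 0 0] by simp

section \<open>Finitely supported families\<close>

definition supp :: "('s \<Rightarrow> 'e) \<Rightarrow> 's set"
  where "supp u = {s. u s \<noteq> 0}"

definition V :: "('s \<Rightarrow> 'e) set"
  where "V = {u. finite (supp u)}"

definition ipV :: "('s \<Rightarrow> 'e) \<Rightarrow> ('s \<Rightarrow> 'e) \<Rightarrow> 'a"
  where "ipV u v = (\<Sum>s\<in>supp u. \<Sum>t\<in>supp v. ip (K s t (u s)) (v t))"

definition kmap :: "('s \<Rightarrow> 'e) \<Rightarrow> 's \<Rightarrow> 'e"
  where "kmap u t = (\<Sum>s\<in>supp u. K s t (u s))"

definition single :: "'s \<Rightarrow> 'e \<Rightarrow> 's \<Rightarrow> 'e"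
  where "single s x = (\<lambda>t. if t = s then x else 0)"

lemma finite_supp: "u \<in> V \<Longrightarrow> finite (supp u)"
  by (simp add: V_def)

lemma kmap_eq: "\<lbrakk>finite A; supp u \<subseteq> A\<rbrakk> \<Longrightarrow> kmap u t = (\<Sum>s\<in>A. K s t (u s))"
  unfolding kmap_def by (rule sum.mono_neutral_left) (auto simp: supp_def)

lemma ipV_eq_kmap: "u \<in> V \<Longrightarrow> ipV u v = (\<Sum>t\<in>supp v. ip (kmap u t) (v t))"
  unfolding ipV_def kmap_def by (subst sum.swap) (simp add: E.ip_sum_left)

lemma ipV_eq:
  assumes "finite A" "supp u \<subseteq> A" "finite B" "supp v \<subseteq> B"
  shows "ipV u v = (\<Sum>s\<in>A. \<Sum>t\<in>B. ip (K s t (u s)) (v t))"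
proof -
  have "ipV u v = (\<Sum>s\<in>supp u. \<Sum>t\<in>B. ip (K s t (u s)) (v t))"
    unfolding ipV_def using assms
    by (intro sum.cong sum.mono_neutral_left) (auto simp: supp_def)
  also have "\<dots> = (\<Sum>s\<in>A. \<Sum>t\<in>B. ip (K s t (u s)) (v t))"
    using assms by (intro sum.mono_neutral_left) (auto simp: supp_def)
  finally show ?thesis .
qed

lemma zero_act [simp]: "act 0 a = 0"
  using E.act_add_left[of 0 0 a] by simp

lemma supp_subset:
  "supp (u + v) \<subseteq> supp u \<union> supp v" "supp (u - v) \<subseteq> supp u \<union> supp v"
  "supp (fun_scale smul c u) \<subseteq> supp u" "supp (fun_act act u a) \<subseteq> supp u"
  by (auto simp: supp_def fun_scale_def fun_act_def)

text \<open>Positive definiteness speaks of sequences of length at least two. A set with fewer elements is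
  padded with zero vectors.\<close>
lemma K_sum_nonneg:
  assumes "finite A"
  shows "cstar_nonneg (\<Sum>s\<in>A. \<Sum>t\<in>A. ip (K s t (u s)) (u t))"
proof -
  define m where "m = card A"
  obtain e where e: "bij_betw e {..<m} A"
    using ex_bij_betw_nat_finite[OF assms] by (auto simp: m_def atLeast0LessThan)
  define n where "n = max 2 m"
  define x where "x i = (if i < m then u (e i) else 0)" for i
  have "cstar_nonneg (\<Sum>i<n. \<Sum>j<n. ip (K (e i) (e j) (x i)) (x j))"
    using K_pos_def by (simp add: pos_def_kernel_def n_def)
  also have "(\<Sum>i<n. \<Sum>j<n. ip (K (e i) (e j) (x i)) (x j))
      = (\<Sum>i<m. \<Sum>j<n. ip (K (e i) (e j) (x i)) (x j))"
    by (intro sum.mono_neutral_right) (auto simp: n_def x_def)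
  also have "\<dots> = (\<Sum>i<m. \<Sum>j<m. ip (K (e i) (e j) (x i)) (x j))"
    by (intro sum.cong refl sum.mono_neutral_right) (auto simp: n_def x_def)
  also have "\<dots> = (\<Sum>i<m. \<Sum>j<m. ip (K (e i) (e j) (u (e i))) (u (e j)))"
    by (simp add: x_def)
  also have "\<dots> = (\<Sum>i<m. \<Sum>t\<in>A. ip (K (e i) t (u (e i))) (u t))"
    by (intro sum.cong refl sum.reindex_bij_betw[OF e])
  also have "\<dots> = (\<Sum>s\<in>A. \<Sum>t\<in>A. ip (K s t (u s)) (u t))"
    by (rule sum.reindex_bij_betw[OF e])
  finally show ?thesis .
qed

sublocale F: right_cstar_module "fun_scale smul :: complex \<Rightarrow> ('s \<Rightarrow> 'e) \<Rightarrow> 's \<Rightarrow> 'e" "fun_act act"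
  by (rule right_cstar_module_fun) unfold_locales

lemma V_closed:
  "0 \<in> V" "\<lbrakk>u \<in> V; v \<in> V\<rbrakk> \<Longrightarrow> u + v \<in> V" "u \<in> V \<Longrightarrow> fun_scale smul c u \<in> V"
  "u \<in> V \<Longrightarrow> fun_act act u a \<in> V"
  using finite_subset[OF supp_subset(1)] finite_subset[OF supp_subset(3)]
    finite_subset[OF supp_subset(4)]
  by (auto simp: V_def) (simp add: supp_def)

sublocale V: semi_inner_module "fun_scale smul" "fun_act act" V ipV
proof
  show "act_submodule (fun_scale smul) (fun_act act) V"
    by (auto simp: act_submodule_def F.subspace_def V_closed)
  fix u v w :: "'s \<Rightarrow> 'e" and c a
  assume u: "u \<in> V"
  show "cstar_nonneg (ipV u u)"
    unfolding ipV_def by (rule K_sum_nonneg[OF finite_supp[OF u]])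
  assume v: "v \<in> V"
  note fin = finite_supp[OF u] finite_supp[OF v]
  show "ipV u (fun_scale smul c v) = scaleC c (ipV u v)"
    using fin supp_subset(3)[of c v]
    by (simp add: ipV_eq[of "supp u" u "supp v"])
      (simp add: fun_scale_def E.ip_scale_right
        linear_sum[OF bounded_linear.linear[OF bounded_linear_scaleC]])
  show "ipV u (fun_act act v a) = ipV u v * a"
    using fin supp_subset(4)[of v a]
    by (simp add: ipV_eq[of "supp u" u "supp v"])
      (simp add: fun_act_def E.ip_act_right sum_distrib_right)
  show "ipV v u = star (ipV u v)"
  proof -
    have "star (ipV u v) = (\<Sum>s\<in>supp u. \<Sum>t\<in>supp v. star (ip (K s t (u s)) (v t)))"
      unfolding ipV_def by (simp add: linear_sum[OF bounded_linear.linear[OF bounded_linear_star]])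
    also have "\<dots> = (\<Sum>s\<in>supp u. \<Sum>t\<in>supp v. ip (K t s (v t)) (u s))"
      by (intro sum.cong refl) (simp add: ip_K_adjoint[of _ _ "v _"] flip: E.ip_star)
    also have "\<dots> = ipV v u"
      unfolding ipV_def by (rule sum.swap)
    finally show ?thesis ..
  qed
  assume w: "w \<in> V"
  show "ipV u (v + w) = ipV u v + ipV u w"
    using fin finite_supp[OF w] supp_subset(1)[of v w]
    by (simp add: ipV_eq[of "supp u" u "supp v \<union> supp w"] E.ip_add_right sum.distrib)
qed

lemma kmap_add: "\<lbrakk>u \<in> V; v \<in> V\<rbrakk> \<Longrightarrow> kmap (u + v) t = kmap u t + kmap v t"
  using supp_subset(1)[of u v]
  by (simp add: kmap_eq[of "supp u \<union> supp v"] finite_supp K_add sum.distrib)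

lemma kmap_scale: "u \<in> V \<Longrightarrow> kmap (fun_scale smul c u) t = smul c (kmap u t)"
  using supp_subset(3)[of c u]
  by (simp add: kmap_eq[of "supp u"] finite_supp) (simp add: fun_scale_def K_scale E.scale_sum_right)

lemma act_sum: "act (sum f A) a = (\<Sum>i\<in>A. act (f i) a)"
  by (induction A rule: infinite_finite_induct) (simp_all add: E.act_add_left)

lemma kmap_act: "u \<in> V \<Longrightarrow> kmap (fun_act act u a) t = act (kmap u t) a"
  using supp_subset(4)[of u a]
  by (simp add: kmap_eq[of "supp u"] finite_supp) (simp add: fun_act_def K_act act_sum)

lemma kmap_diff: "\<lbrakk>u \<in> V; v \<in> V\<rbrakk> \<Longrightarrow> kmap (u - v) t = kmap u t - kmap v t"
  using kmap_add[of "u - v" v t] by simp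

lemma supp_single: "supp (single s x) \<subseteq> {s}"
  by (auto simp: supp_def single_def)

lemma single_mem_V [simp]: "single s x \<in> V"
  using finite_subset[OF supp_single] by (simp add: V_def)

lemma kmap_single: "kmap (single s x) = kernel_fun K x s"
  using kmap_eq[OF _ supp_single] by (simp add: fun_eq_iff single_def kernel_fun_def)

lemma ipV_single: "u \<in> V \<Longrightarrow> ipV u (single s x) = ip (kmap u s) x"
  using ipV_eq[of "supp u" u "{s}" "single s x"] supp_single finite_supp[of u]
  by (simp add: single_def kmap_def E.ip_sum_left)

lemma kmap_eq_sum_kernel_fun: "u \<in> V \<Longrightarrow> kmap u = (\<Sum>s\<in>supp u. kernel_fun K (u s) s)"
  by (simp add: fun_eq_iff kmap_def kernel_fun_def sum_fun_apply)

text \<open>With \<open>y = kmap u s\<close>, evaluation is a pairing: \<open>\<parallel>y\<parallel>\<^sup>2 = \<parallel>\<langle>u, single s y\<rangle>\<parallel>\<close>. By Cauchy--Schwarz this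
  is at most \<open>\<parallel>u\<parallel> \<parallel>single s y\<parallel>\<close>, and \<open>\<parallel>single s y\<parallel>\<^sup>2 = \<parallel>\<langle>K s s y, y\<rangle>\<parallel>\<close> is bounded by a
  multiple of \<open>\<parallel>y\<parallel>\<^sup>2\<close>.\<close>
lemma kmap_bounded:
  obtains C where "0 \<le> C" "\<And>u. u \<in> V \<Longrightarrow> E.vnorm (kmap u s) \<le> C * V.vnorm u"
proof -
  obtain c where c: "0 \<le> c" "\<And>x. E.vnorm (K s s x) \<le> c * E.vnorm x"
    using E.adjointable_imp_bounded[of "K s s" "K s s"] ip_K_adjoint by auto
  have single: "V.vnorm (single s y) \<le> sqrt c * E.vnorm y" for y
  proof -
    have "(V.vnorm (single s y))\<^sup>2 = norm (ip (K s s y) y)"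
      by (simp add: V.vnorm_sq ipV_single kmap_single kernel_fun_def)
    also have "\<dots> \<le> E.vnorm (K s s y) * E.vnorm y"
      by (rule E.Cauchy_Schwarz) simp_all
    also have "\<dots> \<le> (c * E.vnorm y) * E.vnorm y"
      by (intro mult_right_mono c) simp
    also have "\<dots> = (sqrt c * E.vnorm y)\<^sup>2"
      using c(1) by (simp add: power_mult_distrib, simp add: power2_eq_square)
    finally show ?thesis
      by (rule power2_le_imp_le) (simp add: c(1))
  qed
  have "E.vnorm (kmap u s) \<le> sqrt c * V.vnorm u" if u: "u \<in> V" for u
  proof -
    define y where "y = kmap u s"
    have "E.vnorm y * E.vnorm y = norm (ip y y)"
      using E.vnorm_sq[of y] by (simp add: power2_eq_square)
    also have "\<dots> = norm (ipV u (single s y))"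
      by (simp add: ipV_single u y_def)
    also have "\<dots> \<le> V.vnorm u * V.vnorm (single s y)"
      by (rule V.Cauchy_Schwarz) (simp_all add: u)
    also have "\<dots> \<le> V.vnorm u * (sqrt c * E.vnorm y)"
      by (intro mult_left_mono single) simp
    finally have "E.vnorm y * E.vnorm y \<le> (sqrt c * V.vnorm u) * E.vnorm y"
      by (simp add: mult_ac)
    then have "E.vnorm y \<le> sqrt c * V.vnorm u"
      using c(1) by (metis E.vnorm_nonneg V.vnorm_nonneg mult_nonneg_nonneg mult_right_le_imp_le
          order_le_less real_sqrt_ge_zero)
    then show ?thesis
      by (simp add: y_def)
  qed
  with c(1) show ?thesis
    by (intro that[of "sqrt c"]) simp_all
qed

section \<open>Completion inside the space of functions\<close>

text \<open>Functions of the completed module are pointwise limits of Cauchy sequences of families.\<close>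
definition represents :: "(nat \<Rightarrow> 's \<Rightarrow> 'e) \<Rightarrow> ('s \<Rightarrow> 'e) \<Rightarrow> bool"
  where "represents F f \<longleftrightarrow> V.vCauchy F \<and> (\<forall>s. (\<lambda>n. E.vnorm (kmap (F n) s - f s)) \<longlonglongrightarrow> 0)"

lemma represents_vCauchy: "represents F f \<Longrightarrow> V.vCauchy F"
  by (simp add: represents_def)

lemma represents_mem: "represents F f \<Longrightarrow> F n \<in> V"
  using V.vCauchy_mem by (simp add: represents_def)

lemma vCauchy_represents_ex:
  assumes F: "V.vCauchy F"
  obtains f where "represents F f"
proof -
  have "\<exists>y. (\<lambda>n. E.vnorm (kmap (F n) s - y)) \<longlonglongrightarrow> 0" for s
  proof -
    obtain C where C: "0 \<le> C" "\<And>u. u \<in> V \<Longrightarrow> E.vnorm (kmap u s) \<le> C * V.vnorm u"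
      using kmap_bounded by blast
    have "\<exists>N. \<forall>m\<ge>N. \<forall>n\<ge>N. E.vnorm (kmap (F m) s - kmap (F n) s) < e" if "0 < e" for e
    proof -
      have "0 < e / (C + 1)"
        using that C by simp
      then obtain N where N: "\<forall>m\<ge>N. \<forall>n\<ge>N. V.vnorm (F m - F n) < e / (C + 1)"
        using V.vCauchyD[OF F] by blast
      have "E.vnorm (kmap (F m) s - kmap (F n) s) < e" if "N \<le> m" "N \<le> n" for m n
      proof -
        have "E.vnorm (kmap (F m) s - kmap (F n) s) \<le> C * V.vnorm (F m - F n)"
          using C(2)[of "F m - F n"] V.vCauchy_mem[OF F] by (simp add: kmap_diff)
        also have "\<dots> \<le> (C + 1) * V.vnorm (F m - F n)"
          by (intro mult_right_mono) auto
        also have "\<dots> < e"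
          using N that C(1) by (simp add: pos_less_divide_eq mult.commute add_nonneg_pos)
        finally show ?thesis .
      qed
      then show ?thesis
        by blast
    qed
    then have "E.vCauchy (\<lambda>n. kmap (F n) s)"
      by (simp add: E.vCauchy_def)
    then show ?thesis
      by (rule E.Cauchy_limit_exists) blast
  qed
  then obtain f where "\<And>s. (\<lambda>n. E.vnorm (kmap (F n) s - f s)) \<longlonglongrightarrow> 0"
    by metis
  then have "represents F f"
    unfolding represents_def using F by blast
  then show ?thesis
    by (rule that)
qed

lemma represents_const: "u \<in> V \<Longrightarrow> represents (\<lambda>_. u) (kmap u)"
  by (simp add: represents_def V.vCauchy_const)

lemma represents_add:
  assumes F: "represents F f" and G: "represents G g"
  shows "represents (\<lambda>n. F n + G n) (f + g)"
  unfolding represents_def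
proof (intro conjI allI)
  show "V.vCauchy (\<lambda>n. F n + G n)"
    using F G by (simp add: V.vCauchy_add represents_vCauchy)
  fix s
  let ?a = "\<lambda>n. kmap (F n) s - f s" and ?b = "\<lambda>n. kmap (G n) s - g s"
  have eq: "kmap (F n + G n) s - (f + g) s = ?a n + ?b n" for n
    using represents_mem[OF F] represents_mem[OF G] by (simp add: kmap_add)
  have "(\<lambda>n. E.vnorm (?a n) + E.vnorm (?b n)) \<longlonglongrightarrow> 0 + 0"
    using F G by (intro tendsto_add) (simp_all add: represents_def)
  then have lim: "(\<lambda>n. E.vnorm (?a n) + E.vnorm (?b n)) \<longlonglongrightarrow> 0"
    by simp
  show "(\<lambda>n. E.vnorm (kmap (F n + G n) s - (f + g) s)) \<longlonglongrightarrow> 0"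
    unfolding eq
    by (rule tendsto_sandwich[OF _ _ tendsto_const lim]) (simp_all add: E.vnorm_triangle)
qed

text \<open>Serves for the scalar and the module action, applied as \<open>T\<close> to families and as \<open>g\<close> to their
  values.\<close>
lemma represents_image:
  assumes F: "represents F f" and "V.vCauchy (\<lambda>n. T (F n))"
    and kmap_T: "\<And>u t. u \<in> V \<Longrightarrow> kmap (T u) t = g (kmap u t)"
    and g_diff: "\<And>x y. g x - g y = g (x - y)"
    and g_bound: "\<And>x. E.vnorm (g x) \<le> C * E.vnorm x"
  shows "represents (\<lambda>n. T (F n)) (\<lambda>s. g (f s))"
  unfolding represents_def
proof (intro conjI allI assms(2))
  fix s
  let ?a = "\<lambda>n. kmap (F n) s - f s"
  have eq: "kmap (T (F n)) s - g (f s) = g (?a n)" for n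
    using represents_mem[OF F] by (simp add: kmap_T g_diff)
  have "(\<lambda>n. C * E.vnorm (?a n)) \<longlonglongrightarrow> C * 0"
    using F by (intro tendsto_mult tendsto_const) (simp add: represents_def)
  then have lim: "(\<lambda>n. C * E.vnorm (?a n)) \<longlonglongrightarrow> 0"
    by simp
  show "(\<lambda>n. E.vnorm (kmap (T (F n)) s - g (f s))) \<longlonglongrightarrow> 0"
    unfolding eq by (rule tendsto_sandwich[OF _ _ tendsto_const lim]) (simp_all add: g_bound)
qed

lemma represents_scale:
  assumes "represents F f"
  shows "represents (\<lambda>n. fun_scale smul c (F n)) (fun_scale smul c f)"
  unfolding fun_scale_def[of smul c f]
  by (rule represents_image[OF assms, where C = "cmod c"])
    (simp_all add: V.vCauchy_scale represents_vCauchy[OF assms] kmap_scale E.vnorm_scale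
      E.scale_right_diff_distrib)

lemma represents_act:
  assumes "represents F f"
  shows "represents (\<lambda>n. fun_act act (F n) a) (fun_act act f a)"
  unfolding fun_act_def[of act f a]
  by (rule represents_image[OF assms, where C = "norm a"])
    (simp_all add: V.vCauchy_act represents_vCauchy[OF assms] kmap_act E.act_diff_left
      E.vnorm_act_le[simplified mult.commute])

lemma represents_diff:
  assumes "represents F f" "represents G g"
  shows "represents (\<lambda>n. F n - G n) (f - g)"
  using represents_add[OF assms(1) represents_scale[OF assms(2), of "- 1"]]
  by (simp add: F.scale_minus_left)

lemma LIMSEQ_ipV_of_represents:
  assumes F: "represents F f" and v: "v \<in> V"
  shows "(\<lambda>n. ipV (F n) v) \<longlonglongrightarrow> (\<Sum>t\<in>supp v. ip (f t) (v t))"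
proof -
  have "(\<lambda>n. \<Sum>t\<in>supp v. ip (kmap (F n) t) (v t)) \<longlonglongrightarrow> (\<Sum>t\<in>supp v. ip (f t) (v t))"
    using F by (intro tendsto_sum E.LIMSEQ_ip_left) (simp_all add: represents_def)
  then show ?thesis
    using represents_mem[OF F] by (simp add: ipV_eq_kmap)
qed

text \<open>For fixed \<open>N\<close> the pairing \<open>\<langle>F n, F N\<rangle>\<close> only sees finitely many values of \<open>kmap (F n)\<close>, so it tends to
  \<open>0\<close>; and \<open>\<langle>F n, F n\<rangle>\<close> differs from it by at most \<open>B \<parallel>F n - F N\<parallel>\<close>, which is small for large
  \<open>N\<close>.\<close>
lemma represents_zero_imp_null:
  assumes F: "represents F 0"
  shows "(\<lambda>n. V.vnorm (F n)) \<longlonglongrightarrow> 0"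
proof -
  obtain B where B: "0 < B" "\<And>n. V.vnorm (F n) \<le> B"
    using V.vCauchy_bounded[OF represents_vCauchy[OF F]] by blast
  note mem = represents_mem[OF F]
  have "(\<lambda>n. ipV (F n) (F n)) \<longlonglongrightarrow> 0"
  proof (rule LIMSEQ_I)
    fix e :: real assume e: "0 < e"
    then have "0 < e / (2 * B)"
      using B by simp
    then obtain N where N: "\<forall>m\<ge>N. \<forall>n\<ge>N. V.vnorm (F m - F n) < e / (2 * B)"
      using V.vCauchyD[OF represents_vCauchy[OF F]] by blast
    have "(\<lambda>n. ipV (F n) (F N)) \<longlonglongrightarrow> 0"
      using LIMSEQ_ipV_of_represents[OF F mem, of N] by simp
    then obtain N' where N': "\<forall>n\<ge>N'. norm (ipV (F n) (F N)) < e / 2"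
      using LIMSEQ_D[of "\<lambda>n. ipV (F n) (F N)" 0 "e / 2"] e by auto
    have "norm (ipV (F n) (F n)) < e" if n: "max N N' \<le> n" for n
    proof -
      have "ipV (F n) (F n) = ipV (F n) (F N) + ipV (F n) (F n - F N)"
        by (simp add: V.ip_diff_right mem)
      then have "norm (ipV (F n) (F n)) \<le> norm (ipV (F n) (F N)) + norm (ipV (F n) (F n - F N))"
        by (simp add: norm_triangle_ineq)
      also have "norm (ipV (F n) (F n - F N)) \<le> V.vnorm (F n) * V.vnorm (F n - F N)"
        by (rule V.Cauchy_Schwarz) (simp_all add: mem)
      also have "\<dots> \<le> B * V.vnorm (F n - F N)"
        by (intro mult_right_mono B) simp
      also have "\<dots> \<le> B * (e / (2 * B))"
        using N n B(1) by (intro mult_left_mono) (auto intro: less_imp_le)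
      also have "\<dots> = e / 2"
        using B(1) by simp
      finally show ?thesis
        using N' n by fastforce
    qed
    then show "\<exists>no. \<forall>n\<ge>no. norm (ipV (F n) (F n) - 0) < e"
      by (intro exI[of _ "max N N'"]) simp
  qed
  then have "(\<lambda>n. sqrt (norm (ipV (F n) (F n)))) \<longlonglongrightarrow> sqrt (norm (0::'a))"
    by (intro tendsto_real_sqrt tendsto_norm)
  then show ?thesis
    by (simp add: V.vnorm_def)
qed

definition H :: "('s \<Rightarrow> 'e) set"
  where "H = {f. \<exists>F. represents F f}"

definition rep :: "('s \<Rightarrow> 'e) \<Rightarrow> nat \<Rightarrow> 's \<Rightarrow> 'e"
  where "rep f = (SOME F. represents F f)"

definition ipH :: "('s \<Rightarrow> 'e) \<Rightarrow> ('s \<Rightarrow> 'e) \<Rightarrow> 'a"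
  where "ipH f g = lim (\<lambda>n. ipV (rep f n) (rep g n))"

lemma represents_rep: "f \<in> H \<Longrightarrow> represents (rep f) f"
  using someI_ex[of "\<lambda>F. represents F f"] by (simp add: H_def rep_def)

lemma represents_imp_mem_H: "represents F f \<Longrightarrow> f \<in> H"
  by (auto simp: H_def)

text \<open>The inner product does not depend on the chosen representatives: two sequences
  representing the same function differ by a null sequence.\<close>
lemma LIMSEQ_ipH:
  assumes F: "represents F f" and G: "represents G g"
  shows "(\<lambda>n. ipV (F n) (G n)) \<longlonglongrightarrow> ipH f g"
proof -
  have rep_f: "represents (rep f) f" and rep_g: "represents (rep g) g"
    using F G by (auto intro: represents_rep represents_imp_mem_H)
  have lim: "(\<lambda>n. ipV (rep f n) (rep g n)) \<longlonglongrightarrow> ipH f g"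
    unfolding ipH_def
    using V.convergent_ip[OF represents_vCauchy[OF rep_f] represents_vCauchy[OF rep_g]]
    by (simp add: convergent_LIMSEQ_iff)
  obtain B where B: "\<And>n. V.vnorm (G n) \<le> B"
    using V.vCauchy_bounded[OF represents_vCauchy[OF G]] by blast
  obtain C where C: "\<And>n. V.vnorm (rep f n) \<le> C"
    using V.vCauchy_bounded[OF represents_vCauchy[OF rep_f]] by blast
  let ?e = "\<lambda>n. V.vnorm (F n - rep f n) * B + C * V.vnorm (G n - rep g n)"
  have "?e \<longlonglongrightarrow> 0 * B + C * 0"
    using represents_diff[OF F rep_f] represents_diff[OF G rep_g]
    by (intro tendsto_add tendsto_mult tendsto_const represents_zero_imp_null) simp_all
  then have e: "?e \<longlonglongrightarrow> 0"
    by simp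
  have "norm (ipV (F n) (G n) - ipV (rep f n) (rep g n)) \<le> ?e n" for n
  proof -
    have "norm (ipV (F n) (G n) - ipV (rep f n) (rep g n))
        \<le> V.vnorm (F n - rep f n) * V.vnorm (G n) + V.vnorm (rep f n) * V.vnorm (G n - rep g n)"
      by (rule V.norm_ip_diff_le) (simp_all add: represents_mem[OF F] represents_mem[OF G]
          represents_mem[OF rep_f] represents_mem[OF rep_g])
    also have "\<dots> \<le> ?e n"
      by (intro add_mono mult_left_mono mult_right_mono B C) simp_all
    finally show ?thesis .
  qed
  then have "\<forall>\<^sub>F n in sequentially. norm (ipV (F n) (G n) - ipV (rep f n) (rep g n)) \<le> ?e n"
    by (rule always_eventually[OF allI])
  then have "(\<lambda>n. ipV (F n) (G n) - ipV (rep f n) (rep g n)) \<longlonglongrightarrow> 0"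
    using e by (rule Lim_null_comparison)
  then have "(\<lambda>n. ipV (F n) (G n) - ipV (rep f n) (rep g n) + ipV (rep f n) (rep g n)) \<longlonglongrightarrow> 0 + ipH f g"
    using lim by (rule tendsto_add)
  then show ?thesis
    by simp
qed

lemma kmap_mem_H: "u \<in> V \<Longrightarrow> kmap u \<in> H"
  by (rule represents_imp_mem_H[OF represents_const])

lemma kernel_fun_mem_H: "kernel_fun K x s \<in> H"
  using kmap_mem_H[of "single s x"] by (simp add: kmap_single)

lemma reproducing:
  assumes "f \<in> H"
  shows "ip (f s) x = ipH f (kernel_fun K x s)"
proof -
  note f = represents_rep[OF assms]
  have "(\<lambda>n. ip (kmap (rep f n) s) x) \<longlonglongrightarrow> ip (f s) x"
    using f by (intro E.LIMSEQ_ip_left) (simp_all add: represents_def)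
  then have "(\<lambda>n. ipV (rep f n) (single s x)) \<longlonglongrightarrow> ip (f s) x"
    by (simp add: ipV_single represents_mem[OF f])
  moreover have "(\<lambda>n. ipV (rep f n) (single s x)) \<longlonglongrightarrow> ipH f (kernel_fun K x s)"
    using LIMSEQ_ipH[OF f represents_const[OF single_mem_V]] by (simp add: kmap_single)
  ultimately show ?thesis
    by (rule LIMSEQ_unique)
qed

sublocale H: inner_product_module "fun_scale smul" "fun_act act" H ipH
proof
  have "kmap 0 = 0"
    by (simp add: kmap_def supp_def fun_eq_iff)
  then have "0 \<in> H"
    using kmap_mem_H[OF V_closed(1)] by simp
  then show "act_submodule (fun_scale smul) (fun_act act) H"
    unfolding act_submodule_def F.subspace_def H_def
    using represents_add represents_scale represents_act by blast
  fix f g h :: "'s \<Rightarrow> 'e" and c a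
  assume "f \<in> H"
  then have f: "represents (rep f) f"
    by (rule represents_rep)
  show "cstar_nonneg (ipH f f)"
    by (rule cstar_nonneg_LIMSEQ[OF _ LIMSEQ_ipH[OF f f]])
      (rule V.ip_nonneg[OF represents_mem[OF f]])
  show "f = 0" if "ipH f f = 0"
  proof
    fix s
    obtain C where C: "\<And>u. u \<in> V \<Longrightarrow> E.vnorm (kmap u s) \<le> C * V.vnorm u"
      using kmap_bounded by blast
    have "(\<lambda>n. sqrt (norm (ipV (rep f n) (rep f n)))) \<longlonglongrightarrow> sqrt (norm (ipH f f))"
      by (intro tendsto_real_sqrt tendsto_norm LIMSEQ_ipH f)
    then have "(\<lambda>n. C * V.vnorm (rep f n)) \<longlonglongrightarrow> C * 0"
      using that by (intro tendsto_mult tendsto_const) (simp add: V.vnorm_def)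
    then have lim: "(\<lambda>n. C * V.vnorm (rep f n)) \<longlonglongrightarrow> 0"
      by simp
    have "(\<lambda>n. E.vnorm (kmap (rep f n) s - 0)) \<longlonglongrightarrow> 0"
      by (rule tendsto_sandwich[OF _ _ tendsto_const lim]) (simp_all add: C represents_mem[OF f])
    moreover have "(\<lambda>n. E.vnorm (kmap (rep f n) s - f s)) \<longlonglongrightarrow> 0"
      using f by (simp add: represents_def)
    ultimately show "f s = 0 s"
      using E.limit_unique[of "\<lambda>n. kmap (rep f n) s" "f s" 0] by simp
  qed
  assume "g \<in> H"
  then have g: "represents (rep g) g"
    by (rule represents_rep)
  note mem = represents_mem[OF f] represents_mem[OF g]
  note lim = LIMSEQ_ipH[OF f g]
  show "ipH f (fun_scale smul c g) = scaleC c (ipH f g)"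
    using LIMSEQ_ipH[OF f represents_scale[OF g, of c]]
      bounded_linear.tendsto[OF bounded_linear_scaleC lim, of c]
    by (intro LIMSEQ_unique) (simp_all add: V.ip_scale_right mem)
  show "ipH f (fun_act act g a) = ipH f g * a"
    using LIMSEQ_ipH[OF f represents_act[OF g, of a]] tendsto_mult_right[OF lim, of a]
    by (intro LIMSEQ_unique) (simp_all add: V.ip_act_right mem)
  show "ipH g f = star (ipH f g)"
    using LIMSEQ_ipH[OF g f] bounded_linear.tendsto[OF bounded_linear_star lim]
    by (intro LIMSEQ_unique) (simp_all add: mem flip: V.ip_star)
  assume "h \<in> H"
  then have h: "represents (rep h) h"
    by (rule represents_rep)
  show "ipH f (g + h) = ipH f g + ipH f h"
    using LIMSEQ_ipH[OF f represents_add[OF g h]] tendsto_add[OF lim LIMSEQ_ipH[OF f h]]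
    by (intro LIMSEQ_unique) (simp_all add: V.ip_add_right mem represents_mem[OF h])
qed

lemma LIMSEQ_vnorm_H:
  assumes "represents F f"
  shows "(\<lambda>n. V.vnorm (F n)) \<longlonglongrightarrow> H.vnorm f"
  unfolding V.vnorm_def H.vnorm_def
  by (intro tendsto_real_sqrt tendsto_norm LIMSEQ_ipH assms)

lemma vnorm_kmap: "u \<in> V \<Longrightarrow> H.vnorm (kmap u) = V.vnorm u"
  using LIMSEQ_vnorm_H[OF represents_const] LIMSEQ_unique tendsto_const by blast

lemma represents_approx:
  assumes F: "represents F f"
  shows "(\<lambda>k. H.vnorm (f - kmap (F k))) \<longlonglongrightarrow> 0"
proof (rule LIMSEQ_I)
  fix e :: real assume "0 < e"
  then have "0 < e / 2" by simp
  then obtain N where N: "\<forall>m\<ge>N. \<forall>n\<ge>N. V.vnorm (F m - F n) < e / 2"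
    using V.vCauchyD[OF represents_vCauchy[OF F]] by blast
  have "H.vnorm (f - kmap (F k)) \<le> e / 2" if "N \<le> k" for k
  proof (rule LIMSEQ_le_const2)
    show "(\<lambda>n. V.vnorm (F n - F k)) \<longlonglongrightarrow> H.vnorm (f - kmap (F k))"
      by (intro LIMSEQ_vnorm_H represents_diff F represents_const represents_mem[OF F])
    show "\<exists>M. \<forall>n\<ge>M. V.vnorm (F n - F k) \<le> e / 2"
      using N that less_imp_le by blast
  qed
  then show "\<exists>no. \<forall>k\<ge>no. norm (H.vnorm (f - kmap (F k)) - 0) < e"
    using \<open>0 < e\<close> by fastforce
qed

lemma kmap_dense:
  assumes "f \<in> H" "0 < e"
  obtains u where "u \<in> V" "H.vnorm (f - kmap u) < e"
proof -
  have "\<forall>\<^sub>F k in sequentially. H.vnorm (f - kmap (rep f k)) < e"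
    using represents_approx[OF represents_rep[OF assms(1)]] assms(2) by (rule order_tendstoD(2))
  then obtain k where "H.vnorm (f - kmap (rep f k)) < e"
    by (auto simp: eventually_sequentially)
  then show ?thesis
    using that represents_mem[OF represents_rep[OF assms(1)]] by blast
qed

text \<open>Approximate the terms of a Cauchy sequence in \<open>H\<close> by functions \<open>kmap (U n)\<close>. As \<open>kmap\<close> is
  isometric, \<open>U\<close> is a Cauchy sequence of families, and the function that it represents is the limit.\<close>
lemma H_complete: "Metric_space.mcomplete H (ip_dist H ipH)"
  unfolding H.mcomplete_iff
proof (intro allI impI)
  fix X assume X: "H.vCauchy X"
  note mem = H.vCauchy_mem[OF X]
  have "\<exists>u. u \<in> V \<and> H.vnorm (X n - kmap u) < 1 / real (Suc n)" for n
    using kmap_dense[OF mem, of "1 / real (Suc n)" n] by auto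
  then obtain U where U: "\<And>n. U n \<in> V" "\<And>n. H.vnorm (X n - kmap (U n)) < 1 / real (Suc n)"
    by metis
  have "\<exists>N. \<forall>m\<ge>N. \<forall>n\<ge>N. V.vnorm (U m - U n) < e" if "0 < e" for e
  proof -
    have e: "0 < e / 3"
      using that by simp
    then obtain N where N: "\<forall>m\<ge>N. \<forall>n\<ge>N. H.vnorm (X m - X n) < e / 3"
      using H.vCauchyD[OF X] by blast
    obtain N' where N': "1 / real (Suc N') < e / 3"
      using e by (meson nat_approx_posE)
    have close: "H.vnorm (X n - kmap (U n)) < e / 3" if "N' \<le> n" for n
    proof -
      have "1 / real (Suc n) \<le> 1 / real (Suc N')"
        using that by (simp add: frac_le)
      with U(2)[of n] N' show ?thesis by linarith
    qed
    have "V.vnorm (U m - U n) < e" if "max N N' \<le> m" "max N N' \<le> n" for m n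
    proof -
      have "kmap (U m) - kmap (U n) = kmap (U m - U n)"
        by (simp add: U kmap_diff fun_eq_iff)
      then have "V.vnorm (U m - U n) = H.vnorm (kmap (U m) - kmap (U n))"
        by (simp add: U vnorm_kmap)
      also have "\<dots> \<le> H.vnorm (kmap (U m) - X m) + (H.vnorm (X m - X n) + H.vnorm (X n - kmap (U n)))"
        using U(1) mem kmap_mem_H
        by (meson H.vnorm_diff_triangle add_left_mono order_trans)
      also have "H.vnorm (kmap (U m) - X m) = H.vnorm (X m - kmap (U m))"
        by (rule H.vnorm_diff_commute) (simp_all add: U mem kmap_mem_H)
      finally have "V.vnorm (U m - U n)
          \<le> H.vnorm (X m - kmap (U m)) + (H.vnorm (X m - X n) + H.vnorm (X n - kmap (U n)))" .
      moreover have "H.vnorm (X m - X n) < e / 3" "H.vnorm (X m - kmap (U m)) < e / 3"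
          "H.vnorm (X n - kmap (U n)) < e / 3"
        using N that close by simp_all
      ultimately show ?thesis
        by linarith
    qed
    then show ?thesis by blast
  qed
  then have "V.vCauchy U"
    by (simp add: V.vCauchy_def U)
  then obtain f where f: "represents U f"
    by (rule vCauchy_represents_ex)
  have fH: "f \<in> H"
    using f by (rule represents_imp_mem_H)
  have "(\<lambda>n. 1 / real (Suc n) + H.vnorm (f - kmap (U n))) \<longlonglongrightarrow> 0 + 0"
    by (intro tendsto_add represents_approx f lim_1_over_n[THEN LIMSEQ_Suc])
  then have lim: "(\<lambda>n. 1 / real (Suc n) + H.vnorm (f - kmap (U n))) \<longlonglongrightarrow> 0"
    by simp
  have "H.vnorm (X n - f) \<le> 1 / real (Suc n) + H.vnorm (f - kmap (U n))" for n
    using H.vnorm_diff_triangle[OF mem kmap_mem_H[OF U(1)] fH, of n n] U(2)[of n]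
      H.vnorm_diff_commute[OF fH kmap_mem_H[OF U(1)], of n] by linarith
  then have "(\<lambda>n. H.vnorm (X n - f)) \<longlonglongrightarrow> 0"
    by (intro tendsto_sandwich[OF _ _ tendsto_const lim]) simp_all
  with fH show "\<exists>x\<in>H. (\<lambda>n. H.vnorm (X n - x)) \<longlonglongrightarrow> 0"
    by blast
qed

lemma H_hilbert: "hilbert_function_module smul act H ipH"
  unfolding hilbert_function_module_def
  by unfold_locales (fact H.submodule H.ip_add_right H.ip_scale_right H.ip_act_right H.ip_star
      H.ip_nonneg H.ip_definite H_complete)+

text \<open>The functions \<open>kmap u\<close> are dense and are sums of kernel functions.\<close>
lemma kernel_span_dense:
  "dense_in_module H ipH (act_span (fun_scale smul) (fun_act act) {kernel_fun K x s | x s. True})"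
  unfolding H.dense_in_module_iff
proof (intro conjI ballI allI impI)
  let ?X = "{kernel_fun K x s | x s. True}"
  show "act_span (fun_scale smul) (fun_act act) ?X \<subseteq> H"
    unfolding act_span_def by (rule hull_minimal) (auto simp: kernel_fun_mem_H H.submodule)
  have kmap_span: "kmap u \<in> act_span (fun_scale smul) (fun_act act) ?X" if "u \<in> V" for u
    unfolding act_span_def hull_def kmap_eq_sum_kernel_fun[OF that]
    using F.right_cstar_module_axioms by (auto intro!: act_submodule_sum)
  fix f and e :: real assume "f \<in> H" "0 < e"
  then obtain u where "u \<in> V" "H.vnorm (f - kmap u) < e"
    by (rule kmap_dense)
  then show "\<exists>g\<in>act_span (fun_scale smul) (fun_act act) ?X. H.vnorm (f - g) < e"
    using kmap_span by blast
qed

end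

section \<open>Kernels and feature maps\<close>

text \<open>The kernel factors through \<open>H\<close>, so the sum in question is \<open>\<langle>w, w\<rangle>\<close> for \<open>w\<close> the sum of the images
  of the \<open>x i\<close> under the adjoints of the \<open>\<delta> (s i)\<close>.\<close>
lemma pos_def_kernel_of_feature_map:
  assumes E: "hilbert_cstar_module smul act UNIV ip"
    and K: "\<And>s t. K s t \<in> adjointable_ops UNIV ip UNIV ip"
    and H: "hilbert_cstar_module smulH actH H ipH"
    and \<delta>: "\<And>s. \<delta> s \<in> adjointable_ops H ipH UNIV ip"
    and K_eq: "\<And>s t. K s t = \<delta> t \<circ> adjoint_op H ipH ip (\<delta> s)"
  shows "pos_def_kernel ip K"
  unfolding pos_def_kernel_iff[OF E K]
proof (intro allI impI)
  interpret H: hilbert_cstar_module smulH actH H ipH by fact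
  have "\<forall>s. \<exists>T'. (\<forall>y. T' y \<in> H) \<and> (\<forall>f\<in>H. \<forall>y. ip (\<delta> s f) y = ipH f (T' y))"
    using \<delta> unfolding adjointable_ops_def by blast
  then obtain T' where T': "\<And>s y. T' s y \<in> H" "\<And>s f y. f \<in> H \<Longrightarrow> ip (\<delta> s f) y = ipH f (T' s y)"
    by metis
  have K': "K s t x = \<delta> t (T' s x)" for s t x
    unfolding K_eq comp_apply by (subst H.adjoint_op_eq[of "T' s x"]) (simp_all add: T')
  fix n :: nat and s x
  define w where "w = (\<Sum>i<n. T' (s i) (x i))"
  have "(\<Sum>i<n. \<Sum>j<n. ip (K (s i) (s j) (x i)) (x j)) = ipH w w"
    by (simp add: K' T' w_def H.ip_sum_left H.ip_sum_right H.sum_closed_M) (rule sum.swap)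
  also have "cstar_nonneg (ipH w w)"
    by (rule H.ip_nonneg) (simp add: w_def H.sum_closed_M T')
  finally show "cstar_nonneg (\<Sum>i<n. \<Sum>j<n. ip (K (s i) (s j) (x i)) (x j))" .
qed

text \<open>The reproducing identity exhibits \<open>x \<mapsto> K\<^bsub>x,s\<^esub>\<close> as the adjoint of the evaluation at \<open>s\<close>.\<close>
lemma feature_map_of_reproducing:
  assumes H: "hilbert_function_module smul act H ipH"
    and mem: "\<And>x s. kernel_fun K x s \<in> H"
    and rep: "\<And>f x s. f \<in> H \<Longrightarrow> ip (f s) x = ipH f (kernel_fun K x s)"
  shows "(\<lambda>f. f s) \<in> adjointable_ops H ipH UNIV ip"
    and "K s t = (\<lambda>f. f t) \<circ> adjoint_op H ipH ip (\<lambda>f. f s)"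
proof -
  interpret H: hilbert_cstar_module "fun_scale smul" "fun_act act" H ipH
    using H by (simp add: hilbert_function_module_def)
  show "(\<lambda>f. f s) \<in> adjointable_ops H ipH UNIV ip"
    unfolding adjointable_ops_def using mem rep by (auto intro!: exI[of _ "\<lambda>x. kernel_fun K x s"])
  have "adjoint_op H ipH ip (\<lambda>f. f s) x = kernel_fun K x s" for x
    by (rule H.adjoint_op_eq) (simp_all add: mem rep)
  then show "K s t = (\<lambda>f. f t) \<circ> adjoint_op H ipH ip (\<lambda>f. f s)"
    by (simp add: fun_eq_iff kernel_fun_def)
qed

theorem theorem3p1:
  fixes smul :: "complex \<Rightarrow> 'e::ab_group_add \<Rightarrow> 'e"
    and act :: "'e \<Rightarrow> 'a::cstar_algebra \<Rightarrow> 'e"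
    and ip :: "'e \<Rightarrow> 'e \<Rightarrow> 'a"
    and K :: "'s \<Rightarrow> 's \<Rightarrow> 'e \<Rightarrow> 'e"
  assumes "hilbert_cstar_module smul act UNIV ip"
    and "\<And>s t. K s t \<in> adjointable_ops UNIV ip UNIV ip"
  shows
    "(pos_def_kernel ip K \<longleftrightarrow>
       (\<exists>(H :: ('s \<Rightarrow> 'e) set) ipH.
          hilbert_function_module smul act H ipH \<and>
          (\<forall>x s. kernel_fun K x s \<in> H) \<and>
          dense_in_module H ipH
            (act_span (fun_scale smul) (fun_act act) {kernel_fun K x s | x s. True}) \<and>
          (\<forall>x y s t. ipH (kernel_fun K x s) (kernel_fun K y t) = ip (kernel_fun K x s t) y \<and>
                     ip (kernel_fun K x s t) y = ip (K s t x) y) \<and>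
          (\<forall>f\<in>H. \<forall>x s. ip (f s) x = ipH f (kernel_fun K x s)))) \<and>
     (pos_def_kernel ip K \<longleftrightarrow>
       (\<exists>(H :: ('s \<Rightarrow> 'e) set) ipH (\<delta> :: 's \<Rightarrow> ('s \<Rightarrow> 'e) \<Rightarrow> 'e).
          hilbert_function_module smul act H ipH \<and>
          (\<forall>s. \<delta> s \<in> adjointable_ops H ipH UNIV ip) \<and>
          (\<forall>s. \<forall>f\<in>H. \<delta> s f = f s) \<and>
          (\<forall>s t. K s t = \<delta> t \<circ> adjoint_op H ipH ip (\<delta> s))))"
    (is "(?pos \<longleftrightarrow> (\<exists>H ipH. ?reproducing H ipH)) \<and> (?pos \<longleftrightarrow> (\<exists>H ipH \<delta>. ?feature H ipH \<delta>))")
proof -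
  have reproducing: "\<exists>H ipH. ?reproducing H ipH" if ?pos
  proof -
    interpret E: hilbert_cstar_module smul act UNIV ip by fact
    interpret positive_kernel smul act ip K
      by unfold_locales (fact assms(2) that)+
    have "?reproducing H ipH"
      by (intro conjI allI ballI H_hilbert kernel_fun_mem_H kernel_span_dense
          reproducing reproducing[symmetric])
        (simp_all add: kernel_fun_def)
    then show ?thesis
      by (intro exI[of _ H] exI[of _ ipH])
  qed
  have feature: "\<exists>H ipH \<delta>. ?feature H ipH \<delta>" if ex: "\<exists>H ipH. ?reproducing H ipH"
  proof -
    from ex obtain H ipH where "?reproducing H ipH"
      by (elim exE)
    then have "?feature H ipH (\<lambda>s f. f s)"
      using feature_map_of_reproducing[of smul act H ipH K ip] by blast
    then show ?thesis
      by (intro exI[of _ H] exI[of _ ipH] exI[of _ "\<lambda>s f. f s"])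
  qed
  have positive: ?pos if ex: "\<exists>H ipH \<delta>. ?feature H ipH \<delta>"
  proof -
    from ex obtain H ipH \<delta> where "?feature H ipH \<delta>"
      by (elim exE)
    then show ?pos
      using assms unfolding hilbert_function_module_def
      by (intro pos_def_kernel_of_feature_map[where H = H and ipH = ipH and \<delta> = \<delta>]) auto
  qed
  show ?thesis
    by (rule conjI, rule iffI, erule reproducing, rule positive, erule feature,
        rule iffI, rule feature, erule reproducing, erule positive)
qed

end
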